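(* Let $(\Omega,\Sigma,\mu)$ be a measure space, $X(\mu)$ a $\sigma$-order continuous quasi-Banach function space with the $\sigma$-property, $E$ a Banach space, $p\in(0,\infty)$, and $T\colon X(\mu)\to E$ a linear operator that is $p$-th power factorable with a continuous extension. Then $[i]\colon X(\mu)\to L^p(m_T)\cap L^1(m_T)$ is well defined, $T=I_{m_T}\circ[i]$, and $I_{m_T}\colon L^p(m_T)\cap L^1(m_T)\to E$ is $p$-th power factorable with a continuous extension. Moreover the factorization is optimal: if $\xi$ is a measure on $\Sigma$ with $\xi\ll\mu$, $Z(\xi)$ is a $\sigma$-order continuous quasi-Banach function space such that $[i]\colon X(\mu)\to Z(\xi)$ is well defined, and $S\colon Z(\xi)\to E$ is a linear operator with $T=S\circ[i]$ that is $p$-th power factorable with a continuous extension, then $[i]\colon Z(\xi)\to L^p(m_T)\cap L^1(m_T)$ is well defined and $S=I_{m_T}\circ[i]$.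
   Context: $L^0(\lambda)$: $\lambda$-a.e. classes of $\Sigma$-measurable real functions. Ideal function space: vector subspace $Y(\lambda)\subset L^0(\lambda)$ with $f\in Y(\lambda)$, $|g|\le|f|$ a.e. $\Rightarrow g\in Y(\lambda)$. Quasi-Banach function space: ideal function space complete under a quasi-norm ($\|x\|=0\iff x=0$, $\|\alpha x\|=|\alpha|\|x\|$, $\|x+y\|\le K(\|x\|+\|y\|)$, $K\ge1$) with $|f|\le|g|$ a.e. $\Rightarrow\|f\|\le\|g\|$; $\sigma$-order continuous: $f_n\downarrow0$ a.e. $\Rightarrow\|f_n\|\downarrow0$. $\sigma$-property: $\Omega=\bigcup_n\Omega_n$, $\chi_{\Omega_n}\in X(\mu)$. For a quasi-Banach function space $Y(\lambda)$: $Y(\lambda)^q=\{f:|f|^q\in Y(\lambda)\}$ with quasi-norm $\||f|^q\|_{Y(\lambda)}^{1/q}$, and $Y(\lambda)^{1/p}+Y(\lambda)$ is the set of $f=f_1+f_2$ a.e. with $f_1\in Y(\lambda)^{1/p}$, $f_2\in Y(\lambda)$, quasi-normed by $\inf(\|f_1\|_{Y(\lambda)^{1/p}}+\|f_2\|_{Y(\lambda)})$. A linear $R\colon Y(\lambda)\to E$ is $p$-th power factorable with a continuous extension if there is a continuous linear $\tilde R\colon Y(\lambda)^{1/p}+Y(\lambda)\to E$ with $\tilde R=R$ on $Y(\lambda)$. For $\xi\ll\lambda$, $[i]$ maps the $\lambda$-class of $f$ to its $\xi$-class; "$[i]\colon Y(\lambda)\to W(\xi)$ is well defined" means $\xi\ll\lambda$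 and the $\xi$-class of each $f\in Y(\lambda)$ lies in $W(\xi)$. $\Sigma_{X(\mu)}=\{A\in\Sigma:\chi_A\in X(\mu)\}$ ($\delta$-ring with local $\sigma$-algebra $\Sigma$), $m_T(A)=T(\chi_A)$ on $\Sigma_{X(\mu)}$ (a vector measure under the hypotheses). For a vector measure $m$ on $\Sigma_{X(\mu)}$: $|x^*m|$ the variation of $x^*\circ m$ on $\Sigma$, $\|m\|=\sup_{x^*\in B_{E^*}}|x^*m|$, $L^0(m)$ = $\Sigma$-measurable functions modulo $\|m\|$-null sets; $L^1(m)$ = those $f\in L^0(m)$ with $f\in L^1(|x^*m|)$ for all $x^*$ and, for each $A\in\Sigma$, some $\int_Af\,dm\in E$ with $x^*(\int_Af\,dm)=\int_Af\,dx^*m$ for all $x^*$, with norm $\sup_{x^*\in B_{E^*}}\int|f|d|x^*m|$; $I_m(f)=\int_\Omega f\,dm$; $L^p(m)=\{f:|f|^p\in L^1(m)\}$ with quasi-norm $\||f|^p\|_{L^1(m)}^{1/p}$; $L^p(m_T)\cap L^1(m_T)$ carries the quasi-norm $\max(\|f\|_{L^p(m_T)},\|f\|_{L^1(m_T)})$ and is regarded as a quasi-Banach function space over a measure on $\Sigma$ with the same null sets as $\|m_T\|$. *)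

theory Defs
  imports "HOL-Analysis.Analysis"
begin

(* Functions are handled through representatives: an element of L^0(lambda) is
   represented by a Sigma-measurable real function; all spaces below are closed
   under lambda-a.e. equality and all quasi-norms / operators respect it. *)

definition qBfs :: "'a measure \<Rightarrow> ('a \<Rightarrow> real) set \<Rightarrow> (('a \<Rightarrow> real) \<Rightarrow> real) \<Rightarrow> bool" where
  "qBfs M Y N \<longleftrightarrow>
     Y \<subseteq> borel_measurable M \<and>
     (\<lambda>x. 0) \<in> Y \<and>
     (\<forall>f\<in>Y. \<forall>g\<in>Y. (\<lambda>x. f x + g x) \<in> Y) \<and>
     (\<forall>f\<in>Y. \<forall>c::real. (\<lambda>x. c * f x) \<in> Y) \<and>
     (\<forall>f\<in>Y. \<forall>g\<in>borel_measurable M. (AE x in M. \<bar>g x\<bar> \<le> \<bar>f x\<bar>) \<longrightarrow> g \<in> Y) \<and>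
     (\<forall>f\<in>Y. N f = 0 \<longleftrightarrow> (AE x in M. f x = 0)) \<and>
     (\<forall>f\<in>Y. \<forall>c::real. N (\<lambda>x. c * f x) = \<bar>c\<bar> * N f) \<and>
     (\<exists>K\<ge>1. \<forall>f\<in>Y. \<forall>g\<in>Y. N (\<lambda>x. f x + g x) \<le> K * (N f + N g)) \<and>
     (\<forall>f\<in>Y. \<forall>g\<in>Y. (AE x in M. \<bar>f x\<bar> \<le> \<bar>g x\<bar>) \<longrightarrow> N f \<le> N g) \<and>
     (\<forall>s. (\<forall>n. s n \<in> Y) \<longrightarrow>
          (\<forall>e>0. \<exists>n0. \<forall>m\<ge>n0. \<forall>n\<ge>n0. N (\<lambda>x. s m x - s n x) < e) \<longrightarrow>
          (\<exists>f\<in>Y. (\<lambda>n. N (\<lambda>x. s n x - f x)) \<longlonglongrightarrow> 0))"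

definition sigma_order_continuous :: "'a measure \<Rightarrow> ('a \<Rightarrow> real) set \<Rightarrow> (('a \<Rightarrow> real) \<Rightarrow> real) \<Rightarrow> bool" where
  "sigma_order_continuous M Y N \<longleftrightarrow>
     (\<forall>s. (\<forall>n. s n \<in> Y) \<longrightarrow>
          (AE x in M. (\<forall>n. s (Suc n) x \<le> s n x) \<and> (\<lambda>n. s n x) \<longlonglongrightarrow> 0) \<longrightarrow>
          (\<lambda>n. N (s n)) \<longlonglongrightarrow> 0)"

definition sigma_property :: "'a measure \<Rightarrow> ('a \<Rightarrow> real) set \<Rightarrow> bool" where
  "sigma_property M Y \<longleftrightarrow>
     (\<exists>\<Omega>::nat \<Rightarrow> 'a set. (\<forall>n. \<Omega> n \<in> sets M \<and> (indicator (\<Omega> n) :: 'a \<Rightarrow> real) \<in> Y)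
         \<and> (\<Union>n. \<Omega> n) = space M)"

definition pow_space :: "'a measure \<Rightarrow> ('a \<Rightarrow> real) set \<Rightarrow> real \<Rightarrow> ('a \<Rightarrow> real) set" where
  "pow_space M Y q = {f \<in> borel_measurable M. (\<lambda>x. \<bar>f x\<bar> powr q) \<in> Y}"

definition pow_norm :: "(('a \<Rightarrow> real) \<Rightarrow> real) \<Rightarrow> real \<Rightarrow> ('a \<Rightarrow> real) \<Rightarrow> real" where
  "pow_norm N q f = N (\<lambda>x. \<bar>f x\<bar> powr q) powr (1 / q)"

definition sum_space :: "'a measure \<Rightarrow> ('a \<Rightarrow> real) set \<Rightarrow> real \<Rightarrow> ('a \<Rightarrow> real) set" where
  "sum_space M Y p = {f \<in> borel_measurable M. \<exists>f1 f2. f1 \<in> pow_space M Y (1 / p) \<and> f2 \<in> Y \<and>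
       (AE x in M. f x = f1 x + f2 x)}"

definition sum_norm :: "'a measure \<Rightarrow> ('a \<Rightarrow> real) set \<Rightarrow> (('a \<Rightarrow> real) \<Rightarrow> real) \<Rightarrow> real \<Rightarrow> ('a \<Rightarrow> real) \<Rightarrow> real" where
  "sum_norm M Y N p f = Inf {pow_norm N (1 / p) f1 + N f2 | f1 f2.
       f1 \<in> pow_space M Y (1 / p) \<and> f2 \<in> Y \<and> (AE x in M. f x = f1 x + f2 x)}"

definition linear_on :: "('a \<Rightarrow> real) set \<Rightarrow> (('a \<Rightarrow> real) \<Rightarrow> 'b::real_vector) \<Rightarrow> bool" where
  "linear_on D R \<longleftrightarrow>
     (\<forall>f\<in>D. \<forall>g\<in>D. R (\<lambda>x. f x + g x) = R f + R g) \<and>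
     (\<forall>f\<in>D. \<forall>c::real. R (\<lambda>x. c * f x) = c *\<^sub>R R f)"

definition respects_ae :: "'a measure \<Rightarrow> ('a \<Rightarrow> real) set \<Rightarrow> (('a \<Rightarrow> real) \<Rightarrow> 'b) \<Rightarrow> bool" where
  "respects_ae M D R \<longleftrightarrow> (\<forall>f\<in>D. \<forall>g\<in>D. (AE x in M. f x = g x) \<longrightarrow> R f = R g)"

text \<open>Continuity with respect to the quasi-norm topology (metrizable, so sequential).\<close>
definition qcontinuous :: "('a \<Rightarrow> real) set \<Rightarrow> (('a \<Rightarrow> real) \<Rightarrow> real) \<Rightarrow> (('a \<Rightarrow> real) \<Rightarrow> 'b::topological_space) \<Rightarrow> bool" where
  "qcontinuous D N R \<longleftrightarrow>
     (\<forall>s f. (\<forall>n. s n \<in> D) \<longrightarrow> f \<in> D \<longrightarrow> (\<lambda>n. N (\<lambda>x. s n x - f x)) \<longlonglongrightarrow> 0 \<longrightarrow>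
            (\<lambda>n. R (s n)) \<longlonglongrightarrow> R f)"

definition pth_power_factorable :: "'a measure \<Rightarrow> ('a \<Rightarrow> real) set \<Rightarrow> (('a \<Rightarrow> real) \<Rightarrow> real) \<Rightarrow> real
     \<Rightarrow> (('a \<Rightarrow> real) \<Rightarrow> 'b::real_normed_vector) \<Rightarrow> bool" where
  "pth_power_factorable M Y N p R \<longleftrightarrow>
     (\<exists>R'. linear_on (sum_space M Y p) R' \<and> respects_ae M (sum_space M Y p) R' \<and>
           qcontinuous (sum_space M Y p) (sum_norm M Y N p) R' \<and> (\<forall>f\<in>Y. R' f = R f))"

definition dual_ball :: "('b::real_normed_vector \<Rightarrow> real) set" where
  "dual_ball = {xs. bounded_linear xs \<and> onorm xs \<le> 1}"

definition sigma_X :: "'a measure \<Rightarrow> ('a \<Rightarrow> real) set \<Rightarrow> 'a set set" where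
  "sigma_X M X = {A \<in> sets M. (indicator A :: 'a \<Rightarrow> real) \<in> X}"

definition mT :: "(('a \<Rightarrow> real) \<Rightarrow> 'b) \<Rightarrow> 'a set \<Rightarrow> 'b" where
  "mT T A = T (indicator A)"

definition variation :: "'a set set \<Rightarrow> ('a set \<Rightarrow> real) \<Rightarrow> 'a set \<Rightarrow> ennreal" where
  "variation R \<nu> A = (SUP P \<in> {P. finite P \<and> P \<subseteq> R \<and> disjoint P \<and> \<Union>P \<subseteq> A}.
                         \<Sum>B\<in>P. ennreal \<bar>\<nu> B\<bar>)"

definition pos_variation :: "'a set set \<Rightarrow> ('a set \<Rightarrow> real) \<Rightarrow> 'a set \<Rightarrow> ennreal" where
  "pos_variation R \<nu> A = (SUP B \<in> {B \<in> R. B \<subseteq> A}. ennreal (\<nu> B))"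

definition var_measure :: "'a measure \<Rightarrow> 'a set set \<Rightarrow> ('a set \<Rightarrow> real) \<Rightarrow> 'a measure" where
  "var_measure M R \<nu> = measure_of (space M) (sets M) (variation R \<nu>)"

definition pos_measure :: "'a measure \<Rightarrow> 'a set set \<Rightarrow> ('a set \<Rightarrow> real) \<Rightarrow> 'a measure" where
  "pos_measure M R \<nu> = measure_of (space M) (sets M) (pos_variation R \<nu>)"

definition neg_measure :: "'a measure \<Rightarrow> 'a set set \<Rightarrow> ('a set \<Rightarrow> real) \<Rightarrow> 'a measure" where
  "neg_measure M R \<nu> = measure_of (space M) (sets M) (pos_variation R (\<lambda>B. - \<nu> B))"

definition scalar_int :: "'a measure \<Rightarrow> 'a set set \<Rightarrow> ('a set \<Rightarrow> real) \<Rightarrow> 'a set \<Rightarrow> ('a \<Rightarrow> real) \<Rightarrow> real" where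
  "scalar_int M R \<nu> A f =
     (\<integral>x. indicator A x * f x \<partial>pos_measure M R \<nu>) - (\<integral>x. indicator A x * f x \<partial>neg_measure M R \<nu>)"

definition vm_null :: "'a measure \<Rightarrow> 'a set set \<Rightarrow> ('a set \<Rightarrow> 'b::real_normed_vector) \<Rightarrow> 'a set \<Rightarrow> bool" where
  "vm_null M R m A \<longleftrightarrow> A \<in> sets M \<and> (\<forall>xs\<in>dual_ball. variation R (\<lambda>B. xs (m B)) A = 0)"

text \<open>A measure on Sigma with the same null sets as the semivariation of m.\<close>
definition ctrl_measure :: "'a measure \<Rightarrow> 'a set set \<Rightarrow> ('a set \<Rightarrow> 'b::real_normed_vector) \<Rightarrow> 'a measure" where
  "ctrl_measure M R m = measure_of (space M) (sets M) (\<lambda>A. if vm_null M R m A then 0 else \<infinity>)"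

definition vm_L1 :: "'a measure \<Rightarrow> 'a set set \<Rightarrow> ('a set \<Rightarrow> 'b::real_normed_vector) \<Rightarrow> ('a \<Rightarrow> real) set" where
  "vm_L1 M R m = {f \<in> borel_measurable M.
      (\<forall>xs\<in>dual_ball. integrable (var_measure M R (\<lambda>B. xs (m B))) f) \<and>
      (\<forall>A\<in>sets M. \<exists>v. \<forall>xs\<in>dual_ball. xs v = scalar_int M R (\<lambda>B. xs (m B)) A f)}"

definition vm_L1_norm :: "'a measure \<Rightarrow> 'a set set \<Rightarrow> ('a set \<Rightarrow> 'b::real_normed_vector) \<Rightarrow> ('a \<Rightarrow> real) \<Rightarrow> real" where
  "vm_L1_norm M R m f = enn2real (SUP xs\<in>dual_ball. \<integral>\<^sup>+x. ennreal \<bar>f x\<bar> \<partial>var_measure M R (\<lambda>B. xs (m B)))"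

definition vm_int :: "'a measure \<Rightarrow> 'a set set \<Rightarrow> ('a set \<Rightarrow> 'b::real_normed_vector) \<Rightarrow> ('a \<Rightarrow> real) \<Rightarrow> 'b" where
  "vm_int M R m f = (SOME v. \<forall>xs\<in>dual_ball. xs v = scalar_int M R (\<lambda>B. xs (m B)) (space M) f)"

definition vm_Lp :: "'a measure \<Rightarrow> 'a set set \<Rightarrow> ('a set \<Rightarrow> 'b::real_normed_vector) \<Rightarrow> real \<Rightarrow> ('a \<Rightarrow> real) set" where
  "vm_Lp M R m p = {f \<in> borel_measurable M. (\<lambda>x. \<bar>f x\<bar> powr p) \<in> vm_L1 M R m}"

definition vm_Lp_norm :: "'a measure \<Rightarrow> 'a set set \<Rightarrow> ('a set \<Rightarrow> 'b::real_normed_vector) \<Rightarrow> real \<Rightarrow> ('a \<Rightarrow> real) \<Rightarrow> real" where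
  "vm_Lp_norm M R m p f = vm_L1_norm M R m (\<lambda>x. \<bar>f x\<bar> powr p) powr (1 / p)"

definition LpL1 :: "'a measure \<Rightarrow> 'a set set \<Rightarrow> ('a set \<Rightarrow> 'b::real_normed_vector) \<Rightarrow> real \<Rightarrow> ('a \<Rightarrow> real) set" where
  "LpL1 M R m p = vm_Lp M R m p \<inter> vm_L1 M R m"

definition LpL1_norm :: "'a measure \<Rightarrow> 'a set set \<Rightarrow> ('a set \<Rightarrow> 'b::real_normed_vector) \<Rightarrow> real \<Rightarrow> ('a \<Rightarrow> real) \<Rightarrow> real" where
  "LpL1_norm M R m p f = max (vm_Lp_norm M R m p f) (vm_L1_norm M R m f)"

end

(* Let U extend T continuously to X^(1/p) + X.  On each of the spaces D = X and D = X^(1/p) the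
   operator U is bounded on order intervals and sigma-order continuous.  For x* in the dual unit
   ball, x* o U is then an order bounded functional on D; one half of the Riesz-Kantorovich formula
   bounds the positive and negative variations of x* o m_T by it, and approximation from below by
   functions supported in the sets of the sigma-property gives x*(U f) = int f d(x* m_T).  Hence D is
   contained in L^1(m_T) and U f = int f dm_T on D.  For D = X this is the factorization; for
   D = X^(1/p) it says that |f|^p is integrable for f in X, that is, X is contained in L^p(m_T).  The
   same argument applied to Z(xi) and S, still with the sets of Sigma_X, gives optimality.  Finally,
   Y = L^p(m_T) \<inter> L^1(m_T) satisfies Y^(1/p) + Y \<subseteq> L^1(m_T) with |int f dm_T| at most the sum norm, so
   integration itself is the required extension; finiteness of the L^1-norm comes from the uniform
   boundedness principle. *)

theory Submission
  imports Defs
begin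

subsection \<open>Norming functionals and uniform boundedness\<close>

text \<open>The obstacle is that m_T lives on a ring of sets that may miss the whole space, so its
  scalar versions need not be signed measures on Sigma and their variations may be infinite. The
  positive and the negative variation are still measures on all of Sigma, finite on Sigma_X, and
  order boundedness makes both integrals finite for functions in D, so that their difference makes
  sense. Scalar integrals alone do not give membership in L^1(m_T): a vector must represent the
  integral over each A, and U(chi_A f) is that vector because D is solid. The spaces X and X^(1/p)
  are handled separately because order continuity passes from X to X^q through t \<mapsto> t^q,
  whereas on the sum a whole decreasing sequence would have to be decomposed. The target space is an
  intersection for a similar reason: f in Y^(1/p) means that |f|^(1/p) lies in Y, and its L^p part
  says exactly that f is in L^1, while the L^1 part of Y serves the second summand.\<close>

definition sublinear :: "('b::real_vector \<Rightarrow> real) \<Rightarrow> bool" where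
  "sublinear q \<longleftrightarrow> (\<forall>a\<ge>0. \<forall>b\<ge>0. \<forall>x y. q (a *\<^sub>R x + b *\<^sub>R y) \<le> a * q x + b * q y)"

lemma sublinearD:
  "sublinear q \<Longrightarrow> 0 \<le> a \<Longrightarrow> 0 \<le> b \<Longrightarrow> q (a *\<^sub>R x + b *\<^sub>R y) \<le> a * q x + b * q y"
  by (auto simp: sublinear_def)

lemma sublinear_add: "sublinear q \<Longrightarrow> q (x + y) \<le> q x + q y"
  using sublinearD[of q 1 1 x y] by simp

lemma sublinear_scale: "sublinear q \<Longrightarrow> 0 \<le> a \<Longrightarrow> q (a *\<^sub>R x) \<le> a * q x"
  using sublinearD[of q a 0 x x] by simp

lemma sublinear_zero: "sublinear q \<Longrightarrow> q 0 = 0"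
  using sublinear_scale[of q 0 0] sublinear_add[of q 0 0] by simp

lemma sublinear_minus: "sublinear q \<Longrightarrow> - q (- x) \<le> q x"
  using sublinear_add[of q x "- x"] sublinear_zero[of q] by simp

lemma le_if_le_add_eps:
  fixes L R c :: real
  assumes "\<And>e. 0 < e \<Longrightarrow> L \<le> R + c * e" "0 \<le> c"
  shows "L \<le> R"
proof (rule field_le_epsilon)
  fix e :: real assume e: "0 < e"
  \<comment> \<open>Dividing by c + 1 instead of c covers c = 0.\<close>
  have "c * (e / (c + 1)) \<le> e" using assms(2) e by (simp add: field_simps)
  with assms(1)[of "e / (c + 1)"] assms(2) e show "L \<le> R + e" by simp
qed

text \<open>Near-minimisers i for x and j for y are merged into one index k. The merged index is a *
  t + b * s in the case of \<open>tilt\<close>, and the smaller of two functionals in a chain for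
  Zorn's lemma.\<close>

lemma sublinear_INF:
  assumes ne: "I \<noteq> {}" and bdd: "\<And>x. bdd_below ((\<lambda>i. q i x) ` I)"
    and step: "\<And>a b x y i j. 0 \<le> a \<Longrightarrow> 0 \<le> b \<Longrightarrow> i \<in> I \<Longrightarrow> j \<in> I \<Longrightarrow>
      \<exists>k\<in>I. q k (a *\<^sub>R x + b *\<^sub>R y) \<le> a * q i x + b * q j y"
  shows "sublinear (\<lambda>x::'b::real_vector. INF i\<in>I. q i x :: real)"
  unfolding sublinear_def
proof (intro allI impI)
  fix a b :: real and x y :: 'b
  assume a: "0 \<le> a" and b: "0 \<le> b"
  let ?u = "\<lambda>x. INF i\<in>I. q i x"
  show "?u (a *\<^sub>R x + b *\<^sub>R y) \<le> a * ?u x + b * ?u y"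
  proof (rule le_if_le_add_eps[where c = "a + b"])
    fix e :: real assume e: "0 < e"
    obtain i where i: "i \<in> I" "q i x < ?u x + e"
      using cINF_less_iff[OF ne bdd, of x "?u x + e"] e by auto
    obtain j where j: "j \<in> I" "q j y < ?u y + e"
      using cINF_less_iff[OF ne bdd, of y "?u y + e"] e by auto
    obtain k where k: "k \<in> I" "q k (a *\<^sub>R x + b *\<^sub>R y) \<le> a * q i x + b * q j y"
      using step[OF a b i(1) j(1)] by blast
    have "?u (a *\<^sub>R x + b *\<^sub>R y) \<le> q k (a *\<^sub>R x + b *\<^sub>R y)"
      by (rule cINF_lower[OF bdd k(1)])
    also have "\<dots> \<le> a * (?u x + e) + b * (?u y + e)"
      using k(2) mult_left_mono[OF less_imp_le[OF i(2)] a] mult_left_mono[OF less_imp_le[OF j(2)] b]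
      by linarith
    finally show "?u (a *\<^sub>R x + b *\<^sub>R y) \<le> a * ?u x + b * ?u y + (a + b) * e"
      by (simp add: algebra_simps)
  qed (use a b in simp)
qed

text \<open>The largest sublinear functional below \<open>q\<close> whose value at \<open>- v\<close> is at most \<open>- q v\<close>. A minimal
  sublinear functional equals all its tilts, which makes it additive.\<close>

definition tilt :: "('b::real_vector \<Rightarrow> real) \<Rightarrow> 'b \<Rightarrow> 'b \<Rightarrow> real" where
  "tilt q v x = (INF t\<in>{0..}. q (x + t *\<^sub>R v) - t * q v)"

text \<open>The lower bound is uniform in t: homogeneity turns t * q v into q (t v), and t v = (x +
  t v) + (- x).\<close>

lemma tilt_bdd:
  assumes "sublinear q"
  shows "bdd_below ((\<lambda>t. q (x + t *\<^sub>R v) - t * q v) ` {0..})"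
proof (rule bdd_belowI2)
  fix t :: real assume "t \<in> {0..}"
  then have t: "0 \<le> t" by simp
  have q0: "q 0 = 0" by (rule sublinear_zero[OF assms])
  have "t * q v = q (t *\<^sub>R v)"
  proof (cases "t = 0")
    case False
    have "q v \<le> (1 / t) * q (t *\<^sub>R v)"
      using sublinear_scale[OF assms, of "1 / t" "t *\<^sub>R v"] t False by simp
    then have "t * q v \<le> q (t *\<^sub>R v)" using t False by (simp add: field_simps)
    then show ?thesis using sublinear_scale[OF assms t, of v] by simp
  qed (simp add: q0)
  also have "\<dots> \<le> q (x + t *\<^sub>R v) + q (- x)"
    using sublinear_add[OF assms, of "x + t *\<^sub>R v" "- x"] by simp
  finally show "- q (- x) \<le> q (x + t *\<^sub>R v) - t * q v" by simp
qed

text \<open>Two values of t matter below: t = 0 puts the tilt below q, and t = 1 carries the gain at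
  - v, from which a minimal q becomes superadditive.\<close>

lemma tilt_le: "sublinear q \<Longrightarrow> 0 \<le> t \<Longrightarrow> tilt q v x \<le> q (x + t *\<^sub>R v) - t * q v"
  unfolding tilt_def by (rule cINF_lower[OF tilt_bdd]) auto

lemma sublinear_tilt:
  assumes q: "sublinear q"
  shows "sublinear (tilt q v)"
  unfolding tilt_def
proof (rule sublinear_INF)
  fix a b t s :: real and x y
  assume ab: "0 \<le> a" "0 \<le> b" and "t \<in> {0..}" "s \<in> {0..}"
  then have "a * t + b * s \<in> {0..}" by simp
  moreover have "q (a *\<^sub>R x + b *\<^sub>R y + (a * t + b * s) *\<^sub>R v) - (a * t + b * s) * q v
      \<le> a * (q (x + t *\<^sub>R v) - t * q v) + b * (q (y + s *\<^sub>R v) - s * q v)"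
    using sublinearD[OF q ab, of "x + t *\<^sub>R v" "y + s *\<^sub>R v"] by (simp add: algebra_simps)
  ultimately show "\<exists>k\<in>{0..}. q (a *\<^sub>R x + b *\<^sub>R y + k *\<^sub>R v) - k * q v
      \<le> a * (q (x + t *\<^sub>R v) - t * q v) + b * (q (y + s *\<^sub>R v) - s * q v)" by blast
qed (use tilt_bdd[OF q] in auto)

lemma minimal_sublinear_linear:
  assumes q: "sublinear q" and min: "\<And>r. sublinear r \<Longrightarrow> r \<le> q \<Longrightarrow> r = q"
  shows "linear q"
proof -
  have "tilt q v = q" for v
  proof (rule min[OF sublinear_tilt[OF q]])
    show "tilt q v \<le> q" using tilt_le[OF q, of 0 v] by (auto simp: le_fun_def)
  qed
  then have "q x \<le> q (x + v) - q v" for x v using tilt_le[OF q, of 1 v x] by simp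
  then have add: "q (x + y) = q x + q y" for x y
    using sublinear_add[OF q, of x y] by (smt (verit))
  have minus: "q (- x) = - q x" for x using add[of x "- x"] sublinear_zero[OF q] by simp
  have pos: "q (c *\<^sub>R x) = c * q x" if "0 \<le> c" for c x
    using sublinear_scale[OF q that, of x] sublinear_scale[OF q that, of "- x"] minus[of "c *\<^sub>R x"] minus[of x]
    by simp
  show ?thesis
  proof (rule linearI)
    fix c x show "q (c *\<^sub>R x) = c *\<^sub>R q x"
      using pos[of c x] pos[of "- c" x] minus[of "c *\<^sub>R x"] by (cases "0 \<le> c") auto
  qed (rule add)
qed

lemma exists_minimal_sublinear:
  fixes p :: "'b::real_vector \<Rightarrow> real"
  assumes p: "sublinear p"
  shows "\<exists>q. sublinear q \<and> q \<le> p \<and> (\<forall>r. sublinear r \<longrightarrow> r \<le> q \<longrightarrow> r = q)"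
proof -
  let ?A = "{q. sublinear q \<and> q \<le> p}"
  \<comment> \<open>The order is reversed, so upper bounds of chains are pointwise infima and
    maximal elements are minimal functionals.\<close>
  let ?P = "\<lambda>a u :: 'b \<Rightarrow> real. u \<le> a"
  have "\<exists>m\<in>?A. \<forall>a\<in>?A. ?P m a \<longrightarrow> a = m"
  proof (rule predicate_Zorn)
    show "partial_order_on ?A (relation_of ?P ?A)"
      by (rule partial_order_on_relation_ofI) auto
  next
    fix C assume C: "C \<in> Chains (relation_of ?P ?A)"
    then have CA: "C \<subseteq> ?A" and tot: "\<And>q r. q \<in> C \<Longrightarrow> r \<in> C \<Longrightarrow> q \<le> r \<or> r \<le> q"
      by (auto simp: Chains_def relation_of_def)
    show "\<exists>u\<in>?A. \<forall>a\<in>C. u \<le> a"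
    proof (cases "C = {}")
      case True
      then show ?thesis using p by blast
    next
      case False
      \<comment> \<open>Every sublinear functional below p is at least - p (- x) at x, so the
        infimum over the chain is a real number.\<close>
      have bdd: "bdd_below ((\<lambda>q. q x) ` C)" for x
      proof (rule bdd_belowI2)
        fix q assume "q \<in> C"
        then have "sublinear q" "q (- x) \<le> p (- x)" using CA by (auto simp: le_fun_def)
        then show "- p (- x) \<le> q x" using sublinear_minus[of q x] by linarith
      qed
      let ?u = "\<lambda>x. INF q\<in>C. q x"
      have "sublinear ?u"
      proof (rule sublinear_INF[OF False bdd])
        fix a b :: real and x y :: 'b and q r
        assume ab: "0 \<le> a" "0 \<le> b" and qr: "q \<in> C" "r \<in> C"
        have *: "\<exists>k\<in>C. k \<le> q \<and> k \<le> r" using tot[OF qr] qr by blast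
        then obtain k where k: "k \<in> C" "k \<le> q" "k \<le> r" by blast
        have "k (a *\<^sub>R x + b *\<^sub>R y) \<le> a * k x + b * k y"
          using k(1) CA sublinearD[OF _ ab] by blast
        also have "\<dots> \<le> a * q x + b * r y"
          using k ab by (intro add_mono mult_left_mono) (auto simp: le_fun_def)
        finally show "\<exists>k\<in>C. k (a *\<^sub>R x + b *\<^sub>R y) \<le> a * q x + b * r y" using k(1) by blast
      qed
      moreover have low: "?u \<le> q" if "q \<in> C" for q
        unfolding le_fun_def using cINF_lower[OF bdd that] by blast
      moreover have "?u \<le> p"
      proof -
        obtain q where "q \<in> C" using False by blast
        then show ?thesis using low[of q] CA by (auto intro: order_trans)
      qed
      ultimately show ?thesis by blast
    qed
  qed
  then obtain m where m: "sublinear m" "m \<le> p" "\<And>a. sublinear a \<Longrightarrow> a \<le> p \<Longrightarrow> a \<le> m \<Longrightarrow> a = m"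
    by blast
  then show ?thesis by (metis order_trans)
qed

section \<open>The dual unit ball: Hahn-Banach and uniform boundedness\<close>

lemma dual_ball_iff:
  "f \<in> dual_ball \<longleftrightarrow> linear f \<and> (\<forall>x::'b::real_normed_vector. \<bar>f x\<bar> \<le> norm x)"
proof
  assume "f \<in> dual_ball"
  then have f: "bounded_linear f" "onorm f \<le> 1" by (auto simp: dual_ball_def)
  have "\<bar>f x\<bar> \<le> norm x" for x
    using onorm[OF f(1), of x] mult_right_mono[OF f(2) norm_ge_zero[of x]] by simp
  then show "linear f \<and> (\<forall>x. \<bar>f x\<bar> \<le> norm x)" using f(1) bounded_linear.linear by blast
next
  assume f: "linear f \<and> (\<forall>x. \<bar>f x\<bar> \<le> norm x)"
  then have "bounded_linear f" by (intro linear_conv_bounded_linear[THEN iffD1] bounded_linear_intro[where K = 1])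
      (auto simp: linear_add linear_scale)
  moreover have "onorm f \<le> 1" by (rule onorm_bound) (use f in auto)
  ultimately show "f \<in> dual_ball" by (simp add: dual_ball_def)
qed

text \<open>Hahn-Banach with no subspace to extend from: everything below the norm tilted by v is at
  most - norm v at - v, and a minimal sublinear functional below that tilt is linear.\<close>

theorem exists_norming_functional:
  fixes v :: "'b::real_normed_vector"
  shows "\<exists>f\<in>dual_ball. f v = norm v"
proof -
  have n: "sublinear (norm :: 'b \<Rightarrow> real)"
    unfolding sublinear_def
    by (smt (verit, best) abs_of_nonneg norm_scaleR norm_triangle_ineq)
  obtain f where f: "sublinear f" "f \<le> tilt norm v"
      and min: "\<And>r. sublinear r \<Longrightarrow> r \<le> f \<Longrightarrow> r = f"
    using exists_minimal_sublinear[OF sublinear_tilt[OF n, of v]] by blast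
  have lin: "linear f" by (rule minimal_sublinear_linear[OF f(1) min])
  have le: "f x \<le> norm x" for x
    using f(2) tilt_le[OF n, of 0 v x] by (force simp: le_fun_def intro: order_trans)
  have "f (- v) \<le> - norm v"
    using f(2) tilt_le[OF n, of 1 v "- v"] by (force simp: le_fun_def intro: order_trans)
  then have "f v = norm v" using le[of v] linear_neg[OF lin, of v] by simp
  moreover have "\<bar>f x\<bar> \<le> norm x" for x
    using le[of x] le[of "- x"] linear_neg[OF lin, of x] by simp
  ultimately show ?thesis using lin by (auto simp: dual_ball_iff)
qed

lemma dual_ball_eqI:
  fixes v w :: "'b::real_normed_vector"
  assumes "\<And>f. f \<in> dual_ball \<Longrightarrow> f v = f w"
  shows "v = w"
proof -
  obtain f where "f \<in> dual_ball" "f (v - w) = norm (v - w)"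
    using exists_norming_functional by blast
  then show ?thesis using assms[of f] by (simp add: dual_ball_iff linear_diff)
qed

text \<open>A gliding hump in the dual: a series of norming functionals with weights 3^-(n+1) is
  arranged so that its n-th term dominates at w n. The one-sided bound in the hypothesis suffices
  because the dual ball is symmetric.\<close>

lemma weakly_bounded_imp_bounded:
  fixes W :: "'b::real_normed_vector set"
  assumes wb: "\<And>f. f \<in> dual_ball \<Longrightarrow> \<exists>c. \<forall>w\<in>W. f w \<le> c"
  shows "\<exists>c. \<forall>w\<in>W. norm w \<le> c"
proof (rule ccontr)
  assume "\<nexists>c. \<forall>w\<in>W. norm w \<le> c"
  \<comment> \<open>The hump at w n has height norm (w n) / 3^(n+1), and the later terms remove at
    most half of it; the factor 2 * 3^(n+1) leaves at least n.\<close>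
  then have "\<forall>n::nat. \<exists>w\<in>W. 2 * real n * 3 ^ Suc n < norm w" by (meson not_le)
  then obtain w where w: "\<And>n. w n \<in> W" "\<And>n. 2 * real n * 3 ^ Suc n < norm (w n)" by metis
  have "\<exists>u :: 'b \<Rightarrow>\<^sub>L real. norm u \<le> 1 \<and> blinfun_apply u (w n) = norm (w n)" for n
  proof -
    obtain f where f: "f \<in> dual_ball" "f (w n) = norm (w n)" using exists_norming_functional by blast
    then show ?thesis
      by (intro exI[of _ "Blinfun f"])
        (auto simp: dual_ball_def norm_blinfun.rep_eq bounded_linear_Blinfun_apply)
  qed
  then obtain u :: "nat \<Rightarrow> 'b \<Rightarrow>\<^sub>L real"
    where u: "\<And>n. norm (u n) \<le> 1" "\<And>n. blinfun_apply (u n) (w n) = norm (w n)" by metis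
  \<comment> \<open>Gliding hump: the sign of the n-th term is chosen so that it does not cancel the earlier ones at \<open>w n\<close>.\<close>
  define sg where "sg n x = (if 0 \<le> blinfun_apply x (w n) then (1::real) else - 1)" for n and x :: "'b \<Rightarrow>\<^sub>L real"
  define x where "x = rec_nat 0 (\<lambda>n x. x + (sg n x / 3 ^ Suc n) *\<^sub>R u n)"
  have x0: "x 0 = 0" and xS: "x (Suc n) = x n + (sg n (x n) / 3 ^ Suc n) *\<^sub>R u n" for n
    by (simp_all add: x_def)
  define d where "d n = (sg n (x n) / 3 ^ Suc n) *\<^sub>R u n" for n
  have nd: "norm (d n) \<le> (1 / 3) ^ Suc n" for n
  proof -
    have "norm (d n) = (1 / 3) ^ Suc n * norm (u n)"
      by (simp add: d_def sg_def power_divide)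
    also have "\<dots> \<le> (1 / 3) ^ Suc n" using u(1)[of n] by (simp add: mult_left_le)
    finally show ?thesis .
  qed
  have gs: "(\<lambda>k. (1 / 3 :: real) ^ Suc (k + n)) sums (1 / 2 * (1 / 3) ^ n)" for n
  proof -
    have "(\<lambda>k. (1 / 3) ^ Suc n * (1 / 3 :: real) ^ k) sums ((1 / 3) ^ Suc n * (1 / (1 - 1 / 3)))"
      by (intro sums_mult geometric_sums) simp
    then show ?thesis by (simp add: power_add mult_ac)
  qed
  have sd: "summable d"
    by (rule summable_comparison_test[of _ "\<lambda>k. (1 / 3 :: real) ^ Suc (k + 0)"])
      (use nd sums_summable[OF gs] in auto)
  define y where "y = (\<Sum>n. d n)"
  have x_sum: "x n = (\<Sum>k<n. d k)" for n by (induction n) (simp_all add: x0 xS d_def)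
  have tail: "norm (y - x n) \<le> 1 / 2 * (1 / 3) ^ n" for n
  proof -
    have "norm (y - x n) = norm (\<Sum>k. d (k + n))"
      by (simp add: y_def x_sum suminf_minus_initial_segment[OF sd])
    also have "\<dots> \<le> (\<Sum>k. (1 / 3) ^ Suc (k + n))"
      by (rule norm_suminf_le[OF _ sums_summable[OF gs]]) (rule nd)
    finally show ?thesis using sums_unique[OF gs[of n]] by simp
  qed
  \<comment> \<open>The weights sum to 1/2, which keeps y inside the dual ball.\<close>
  have y_le: "norm y \<le> 1" using tail[of 0] by (simp add: x0)
  have big: "real n \<le> \<bar>blinfun_apply y (w n)\<bar>" for n
  proof -
    let ?e = "(1 / 3 :: real) ^ Suc n"
    have push: "h \<le> \<bar>r + (if 0 \<le> r then 1 else - 1) * h\<bar>" if "0 \<le> h" for r h :: real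
      using that by (cases "0 \<le> r") auto
    have "blinfun_apply (x (Suc n)) (w n) = blinfun_apply (x n) (w n)
        + (if 0 \<le> blinfun_apply (x n) (w n) then 1 else - 1) * (?e * norm (w n))"
      using u(2)[of n] by (simp add: xS sg_def blinfun.add_left blinfun.scaleR_left power_divide)
    with push[of "?e * norm (w n)" "blinfun_apply (x n) (w n)"]
    have 1: "?e * norm (w n) \<le> \<bar>blinfun_apply (x (Suc n)) (w n)\<bar>" by (metis norm_ge_zero zero_le_divide_1_iff zero_le_mult_iff zero_le_numeral zero_le_power)
    have "\<bar>blinfun_apply (y - x (Suc n)) (w n)\<bar> \<le> norm (y - x (Suc n)) * norm (w n)"
      using norm_blinfun[of "y - x (Suc n)" "w n"] by simp
    also have "\<dots> \<le> 1 / 2 * ?e * norm (w n)" by (rule mult_right_mono[OF tail]) simp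
    finally have 2: "\<bar>blinfun_apply y (w n) - blinfun_apply (x (Suc n)) (w n)\<bar> \<le> 1 / 2 * ?e * norm (w n)"
      by (simp add: blinfun.diff_left)
    have "real n = 1 / 2 * ?e * (2 * real n * 3 ^ Suc n)" by (simp add: power_divide)
    also have "\<dots> \<le> 1 / 2 * ?e * norm (w n)" using w(2)[of n] by (intro mult_left_mono) auto
    finally show ?thesis using 1 2 by (simp add: abs_if split: if_splits)
  qed
  let ?f = "blinfun_apply y"
  have f: "?f \<in> dual_ball" "(\<lambda>v. - ?f v) \<in> dual_ball"
    using y_le by (auto simp: dual_ball_def norm_blinfun.rep_eq[symmetric] onorm_neg
      intro: bounded_linear_minus blinfun.bounded_linear_right)
  obtain c where c: "\<And>n. ?f (w n) \<le> c" using wb[OF f(1)] w(1) by blast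
  obtain c' where c': "\<And>n. - ?f (w n) \<le> c'" using wb[OF f(2)] w(1) by blast
  obtain n :: nat where "max c c' < real n" using reals_Archimedean2 by blast
  then show False using big[of n] c[of n] c'[of n] by linarith
qed

subsection \<open>Jordan decomposition of charges on an ideal of sets\<close>

lemma SUP_add_SUP_le:
  fixes f :: "'a \<Rightarrow> ennreal"
  assumes "I \<noteq> {}" "J \<noteq> {}" "\<And>i j. i \<in> I \<Longrightarrow> j \<in> J \<Longrightarrow> f i + g j \<le> c"
  shows "(SUP i\<in>I. f i) + (SUP j\<in>J. g j) \<le> c"
proof -
  have "(SUP i\<in>I. f i) + (SUP j\<in>J. g j) = (SUP i\<in>I. f i + (SUP j\<in>J. g j))"
    by (rule ennreal_SUP_add_left[OF assms(1), symmetric])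
  also have "\<dots> = (SUP i\<in>I. SUP j\<in>J. f i + g j)"
    by (simp only: ennreal_SUP_add_right[OF assms(2)])
  also have "\<dots> \<le> c" by (intro SUP_least assms(3))
  finally show ?thesis .
qed

text \<open>No signs are required because \<open>ennreal\<close> sends negative reals to 0. The same
  truncation lets \<open>pos_variation\<close> do without a positive part.\<close>

lemma ennreal_add_le: "ennreal (a + b) \<le> ennreal a + ennreal b"
proof (cases "0 \<le> a \<and> 0 \<le> b")
  case False
  then have "ennreal (a + b) \<le> ennreal (max a b)" by (intro ennreal_leI) auto
  also have "\<dots> \<le> ennreal a + ennreal b" by (simp add: max_def)
  finally show ?thesis .
qed simp

lemma ennreal_sum_le: "ennreal (\<Sum>i\<in>I. f i) \<le> (\<Sum>i\<in>I. ennreal (f i))"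
proof (induction I rule: infinite_finite_induct)
  case (insert i I)
  have "ennreal (f i + sum f I) \<le> ennreal (f i) + ennreal (sum f I)" by (rule ennreal_add_le)
  also have "\<dots> \<le> ennreal (f i) + (\<Sum>i\<in>I. ennreal (f i))" using insert.IH by (rule add_left_mono)
  finally show ?case using insert by simp
qed simp_all

lemma disjoint_family_lessThan:
  fixes A :: "nat \<Rightarrow> 'a set"
  assumes "disjoint_family A"
  shows "A n \<inter> (\<Union>i<n. A i) = {}"
proof -
  have "A n \<inter> A i = {}" if "i < n" for i
    by (rule disjoint_family_onD[OF assms]) (use that in auto)
  then show ?thesis by blast
qed

text \<open>Models \<open>sigma_X M X\<close>. It need not contain \<open>space M\<close>, but it is
  hereditary, so cutting a member by any measurable set stays inside R.\<close>

locale set_ideal =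
  fixes M :: "'a measure" and R :: "'a set set"
  assumes R_sets: "R \<subseteq> sets M"
    and R_empty: "{} \<in> R"
    and R_subset: "A \<in> R \<Longrightarrow> B \<in> sets M \<Longrightarrow> B \<subseteq> A \<Longrightarrow> B \<in> R"
    and R_Un: "A \<in> R \<Longrightarrow> B \<in> R \<Longrightarrow> A \<union> B \<in> R"
begin

lemma R_in_sets: "A \<in> R \<Longrightarrow> A \<in> sets M"
  using R_sets by blast

lemma R_UN: "(\<And>i. A i \<in> R) \<Longrightarrow> (\<Union>i<n::nat. A i) \<in> R"
proof (induction n)
  case (Suc n)
  have "(\<Union>i<Suc n. A i) = A n \<union> (\<Union>i<n. A i)" by (simp add: lessThan_Suc)
  then show ?case using R_Un[OF Suc.prems Suc.IH[OF Suc.prems]] by (simp only:)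
qed (simp add: R_empty)

lemma R_Diff: "A \<in> R \<Longrightarrow> B \<in> R \<Longrightarrow> A - B \<in> R"
  by (rule R_subset[of A]) (simp_all add: R_in_sets sets.Diff Diff_subset)

end

text \<open>Countable additivity is put as continuity at the empty set since this is what
  sigma-order continuity of an operator supplies. Likewise \<open>bounded\<close> is supplied by
  order boundedness; it makes the positive variation finite on R.\<close>

locale ideal_charge = set_ideal +
  fixes \<nu> :: "'a set \<Rightarrow> real"
  assumes additive: "A \<in> R \<Longrightarrow> B \<in> R \<Longrightarrow> A \<inter> B = {} \<Longrightarrow> \<nu> (A \<union> B) = \<nu> A + \<nu> B"
    and continuous: "(\<And>n::nat. D n \<in> R) \<Longrightarrow> decseq D \<Longrightarrow> (\<Inter>n. D n) = {} \<Longrightarrow> (\<lambda>n. \<nu> (D n)) \<longlonglongrightarrow> 0"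
    and bounded: "A \<in> R \<Longrightarrow> \<exists>c. \<forall>B\<in>R. B \<subseteq> A \<longrightarrow> \<bar>\<nu> B\<bar> \<le> c"

text \<open>The negative variation is the positive one of - \<nu>; through this lemma each result on
  the positive part is transferred to the negative part.\<close>

lemma (in ideal_charge) ideal_charge_uminus: "ideal_charge M R (\<lambda>B. - \<nu> B)"
proof
  fix D :: "nat \<Rightarrow> 'a set"
  assume "\<And>n. D n \<in> R" "decseq D" "(\<Inter>n. D n) = {}"
  from tendsto_minus[OF continuous[OF this]] show "(\<lambda>n. - \<nu> (D n)) \<longlonglongrightarrow> 0" by simp
next
  fix A assume "A \<in> R"
  from bounded[OF this] show "\<exists>c. \<forall>B\<in>R. B \<subseteq> A \<longrightarrow> \<bar>- \<nu> B\<bar> \<le> c" by simp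
qed (simp add: additive)

context ideal_charge
begin

lemma empty [simp]: "\<nu> {} = 0"
  using additive[of "{}" "{}"] R_empty by simp

lemma sum_disjoint:
  assumes "\<And>i. A i \<in> R" "disjoint_family A"
  shows "\<nu> (\<Union>i<n::nat. A i) = (\<Sum>i<n. \<nu> (A i))"
proof (induction n)
  case (Suc n)
  have "A n \<inter> (\<Union>i<n. A i) = {}"
    by (rule disjoint_family_lessThan[OF assms(2)])
  then have "\<nu> (A n \<union> (\<Union>i<n. A i)) = \<nu> (A n) + (\<Sum>i<n. \<nu> (A i))"
    using additive[OF assms(1)[of n] R_UN[of A, OF assms(1)]] Suc.IH by (simp only:)
  then show ?case by (simp add: lessThan_Suc)
qed simp

lemma diff:
  assumes "A \<in> R" "B \<in> R" "B \<subseteq> A"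
  shows "\<nu> (A - B) = \<nu> A - \<nu> B"
proof -
  have "A - B \<in> R" by (rule R_Diff[OF assms(1,2)])
  moreover have "B \<union> (A - B) = A" using assms(3) by blast
  ultimately show ?thesis using additive[OF assms(2), of "A - B"] by simp
qed

lemma sums_disjoint:
  assumes A: "\<And>i. A i \<in> R" "disjoint_family A" and U: "(\<Union>i. A i) \<in> R"
  shows "(\<lambda>i. \<nu> (A i)) sums \<nu> (\<Union>i. A i)"
proof -
  \<comment> \<open>Remainders of the union; they decrease to the empty set and stay in R because
    the whole union does.\<close>
  let ?D = "\<lambda>n. (\<Union>i. A i) - (\<Union>i<n. A i)"
  have D: "?D n \<in> R" for n
    by (rule R_Diff[OF U R_UN[OF A(1)]])
  have "decseq ?D" by (auto simp: decseq_def)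
  moreover have "(\<Inter>n. ?D n) = {}" by auto
  ultimately have "(\<lambda>n. \<nu> (?D n)) \<longlonglongrightarrow> 0" by (rule continuous[OF D])
  moreover have "\<nu> (?D n) = \<nu> (\<Union>i. A i) - (\<Sum>i<n. \<nu> (A i))" for n
    by (subst diff[OF U]) (auto simp: sum_disjoint[OF A, symmetric] intro: R_UN A(1))
  ultimately have "(\<lambda>n. \<nu> (\<Union>i. A i) - (\<nu> (\<Union>i. A i) - (\<Sum>i<n. \<nu> (A i)))) \<longlonglongrightarrow> \<nu> (\<Union>i. A i) - 0"
    by (intro tendsto_diff) simp_all
  then show ?thesis by (simp add: sums_def)
qed

section \<open>The positive variation as a measure on Sigma\<close>

lemma pos_variation_upper: "B \<in> R \<Longrightarrow> B \<subseteq> A \<Longrightarrow> ennreal (\<nu> B) \<le> pos_variation R \<nu> A"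
  unfolding pos_variation_def by (rule SUP_upper) simp

lemma pos_variation_mono: "A \<subseteq> B \<Longrightarrow> pos_variation R \<nu> A \<le> pos_variation R \<nu> B"
  unfolding pos_variation_def by (rule SUP_subset_mono) auto

lemma pos_variation_empty: "pos_variation R \<nu> {} = 0"
proof -
  have "{B \<in> R. B \<subseteq> {}} = {{}}" using R_empty by auto
  then show ?thesis by (simp add: pos_variation_def)
qed

lemma pos_variation_superadditive:
  assumes "A \<inter> B = {}"
  shows "pos_variation R \<nu> A + pos_variation R \<nu> B \<le> pos_variation R \<nu> (A \<union> B)"
  unfolding pos_variation_def[of R \<nu> A] pos_variation_def[of R \<nu> B]
proof (rule SUP_add_SUP_le)
  fix C D assume C: "C \<in> {C \<in> R. C \<subseteq> A}" and D: "D \<in> {C \<in> R. C \<subseteq> B}"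
  show "ennreal (\<nu> C) + ennreal (\<nu> D) \<le> pos_variation R \<nu> (A \<union> B)"
  proof (cases "0 \<le> \<nu> C \<and> 0 \<le> \<nu> D")
    case True
    then have "ennreal (\<nu> C) + ennreal (\<nu> D) = ennreal (\<nu> (C \<union> D))"
      using C D assms by (subst additive) auto
    also have "\<dots> \<le> pos_variation R \<nu> (A \<union> B)"
      using C D by (intro pos_variation_upper R_Un) auto
    finally show ?thesis .
  next
    \<comment> \<open>A negative value counts as 0 under \<open>ennreal\<close>, so C or D alone is
      a sufficient competitor.\<close>
    case False
    then have "ennreal (\<nu> C) + ennreal (\<nu> D) = ennreal (\<nu> C) \<or> ennreal (\<nu> C) + ennreal (\<nu> D) = ennreal (\<nu> D)"
      by (auto simp: ennreal_neg)
    moreover have "ennreal (\<nu> C) \<le> pos_variation R \<nu> (A \<union> B)" "ennreal (\<nu> D) \<le> pos_variation R \<nu> (A \<union> B)"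
      using C D by (intro pos_variation_upper; blast)+
    ultimately show ?thesis by metis
  qed
qed (use R_empty in auto)

text \<open>Additivity holds on all of \<open>sets M\<close> although \<nu> lives on R.
  Superadditivity gives one inequality; for the other, a competitor B in R is cut into the pieces B
  \<inter> A i, again in R, where the countable additivity of \<nu> applies.\<close>

lemma pos_variation_countably_additive: "countably_additive (sets M) (pos_variation R \<nu>)"
proof (rule countably_additiveI)
  fix A :: "nat \<Rightarrow> 'a set"
  assume A: "range A \<subseteq> sets M" "disjoint_family A"
  show "(\<Sum>i. pos_variation R \<nu> (A i)) = pos_variation R \<nu> (\<Union>i. A i)"
  proof (rule antisym)
    have fin: "(\<Sum>i<n. pos_variation R \<nu> (A i)) \<le> pos_variation R \<nu> (\<Union>i<n. A i)" for n
    proof (induction n)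
      case (Suc n)
      have "A n \<inter> (\<Union>i<n. A i) = {}"
        by (rule disjoint_family_lessThan[OF A(2)])
      from pos_variation_superadditive[OF this] Suc show ?case
        by (simp add: lessThan_Suc add.commute) (meson add_left_mono order_trans)
    qed simp
    show "(\<Sum>i. pos_variation R \<nu> (A i)) \<le> pos_variation R \<nu> (\<Union>i. A i)"
      unfolding suminf_eq_SUP
      by (rule SUP_least) (rule order_trans[OF fin pos_variation_mono], auto)
  next
    show "pos_variation R \<nu> (\<Union>i. A i) \<le> (\<Sum>i. pos_variation R \<nu> (A i))"
      unfolding pos_variation_def[of R \<nu> "\<Union>i. A i"]
    proof (rule SUP_least)
      fix B assume "B \<in> {B \<in> R. B \<subseteq> (\<Union>i. A i)}"
      then have B: "B \<in> R" "B \<subseteq> (\<Union>i. A i)" by auto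
      have BA: "B \<inter> A i \<in> R" for i
        by (rule R_subset[OF B(1)]) (use A(1) R_in_sets[OF B(1)] in auto)
      have BU: "(\<Union>i. B \<inter> A i) = B" using B(2) by blast
      have "(\<lambda>i. \<nu> (B \<inter> A i)) sums \<nu> B"
        using sums_disjoint[of "\<lambda>i. B \<inter> A i", OF BA disjoint_family_on_bisimulation[OF A(2)]] B(1)
        unfolding BU by blast
      then have lim: "(\<lambda>n. ennreal (\<Sum>i<n. \<nu> (B \<inter> A i))) \<longlonglongrightarrow> ennreal (\<nu> B)"
        unfolding sums_def by (rule tendsto_ennrealI)
      have "ennreal (\<Sum>i<n. \<nu> (B \<inter> A i)) \<le> (\<Sum>i. pos_variation R \<nu> (A i))" for n
      proof -
        have "ennreal (\<Sum>i<n. \<nu> (B \<inter> A i)) \<le> (\<Sum>i<n. pos_variation R \<nu> (A i))"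
          by (rule order_trans[OF ennreal_sum_le sum_mono]) (use BA in \<open>auto intro: pos_variation_upper\<close>)
        also have "\<dots> \<le> (\<Sum>i. pos_variation R \<nu> (A i))" by (rule sum_le_suminf) auto
        finally show ?thesis .
      qed
      then show "ennreal (\<nu> B) \<le> (\<Sum>i. pos_variation R \<nu> (A i))"
        by (intro LIMSEQ_le_const2[OF lim]) auto
    qed
  qed
qed

section \<open>Jordan decomposition and total variation\<close>

abbreviation "P \<equiv> pos_measure M R \<nu>"
abbreviation "Q \<equiv> neg_measure M R \<nu>"
abbreviation "V \<equiv> var_measure M R \<nu>"

lemma sets_PQV [simp, measurable_cong]: "sets P = sets M" "sets Q = sets M" "sets V = sets M"
  by (simp_all add: pos_measure_def neg_measure_def var_measure_def)

lemma space_PQV [simp]: "space P = space M" "space Q = space M" "space V = space M"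
  by (simp_all add: pos_measure_def neg_measure_def var_measure_def)

lemma emeasure_P: "A \<in> sets M \<Longrightarrow> emeasure P A = pos_variation R \<nu> A"
  unfolding pos_measure_def
  by (rule emeasure_measure_of_sigma)
    (auto simp: sets.sigma_algebra_axioms pos_variation_countably_additive positive_def pos_variation_empty)

lemma Q_eq: "Q = pos_measure M R (\<lambda>B. - \<nu> B)"
  by (simp add: pos_measure_def neg_measure_def)

lemma emeasure_Q: "A \<in> sets M \<Longrightarrow> emeasure Q A = pos_variation R (\<lambda>B. - \<nu> B) A"
  unfolding Q_eq by (rule ideal_charge.emeasure_P[OF ideal_charge_uminus])

lemma emeasure_P_finite: "A \<in> R \<Longrightarrow> emeasure P A < \<infinity>"
proof -
  assume A: "A \<in> R"
  then obtain c where c: "\<And>B. B \<in> R \<Longrightarrow> B \<subseteq> A \<Longrightarrow> \<bar>\<nu> B\<bar> \<le> c" using bounded[OF A] by blast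
  have "pos_variation R \<nu> A \<le> ennreal c"
    unfolding pos_variation_def
  proof (rule SUP_least)
    fix B assume "B \<in> {B \<in> R. B \<subseteq> A}"
    then show "ennreal (\<nu> B) \<le> ennreal c" using c[of B] by (intro ennreal_leI) auto
  qed
  then show ?thesis using emeasure_P[OF R_in_sets[OF A]] by (simp add: le_less_trans)
qed

lemma upper_P:
  assumes "B \<in> R" "B \<subseteq> A" and A: "A \<in> R"
  shows "\<nu> B \<le> measure P A"
proof -
  have "ennreal (\<nu> B) \<le> emeasure P A"
    using pos_variation_upper[OF assms(1,2)] emeasure_P[OF R_in_sets[OF A]] by simp
  also have "\<dots> = ennreal (measure P A)"
    by (rule emeasure_eq_ennreal_measure) (use emeasure_P_finite[OF A] in simp)
  finally show ?thesis by (simp add: ennreal_le_iff)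
qed

lemma upper_Q: "B \<in> R \<Longrightarrow> B \<subseteq> A \<Longrightarrow> A \<in> R \<Longrightarrow> - \<nu> B \<le> measure Q A"
  unfolding Q_eq by (rule ideal_charge.upper_P[OF ideal_charge_uminus])

text \<open>Pass to the complement: \<nu> B = \<nu> A - \<nu> (A - B), and - \<nu> (A - B) is
  bounded by Q. The same inequality for - \<nu> is the other half of the Jordan decomposition, so no
  Hahn decomposition of the space is involved.\<close>

lemma measure_P_le: "A \<in> R \<Longrightarrow> measure P A \<le> \<nu> A + measure Q A"
proof -
  assume A: "A \<in> R"
  have *: "\<nu> B \<le> \<nu> A + measure Q A" if "B \<in> R" "B \<subseteq> A" for B
  proof -
    have "A - B \<in> R" by (rule R_Diff[OF A that(1)])
    then show ?thesis using diff[OF A that] upper_Q[of "A - B" A] A by auto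
  qed
  have "emeasure P A \<le> ennreal (\<nu> A + measure Q A)"
    unfolding emeasure_P[OF R_in_sets[OF A]] pos_variation_def
  proof (rule SUP_least)
    fix B assume "B \<in> {B \<in> R. B \<subseteq> A}"
    then show "ennreal (\<nu> B) \<le> ennreal (\<nu> A + measure Q A)" using *[of B] by (intro ennreal_leI) auto
  qed
  \<comment> \<open>The choice B = {} shows that the right-hand side is nonnegative, so the bound
    survives the return from \<open>ennreal\<close> to the reals.\<close>
  then show ?thesis using emeasure_P_finite[OF A] *[OF R_empty]
    by (simp add: emeasure_eq_ennreal_measure less_top)
qed

lemma jordan_decomposition: "A \<in> R \<Longrightarrow> \<nu> A = measure P A - measure Q A"
  using measure_P_le[of A] ideal_charge.measure_P_le[OF ideal_charge_uminus, of A] unfolding ideal_charge.Q_eq[OF ideal_charge_uminus] Q_eq by simp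

lemma variation_eq:
  assumes A: "A \<in> sets M"
  shows "variation R \<nu> A = emeasure P A + emeasure Q A"
proof (rule antisym)
  show "variation R \<nu> A \<le> emeasure P A + emeasure Q A"
    unfolding variation_def
  proof (rule SUP_least)
    fix F assume "F \<in> {F. finite F \<and> F \<subseteq> R \<and> disjoint F \<and> \<Union>F \<subseteq> A}"
    then have F: "finite F" "F \<subseteq> R" "disjoint F" "\<Union>F \<subseteq> A" by auto
    have FM: "F \<subseteq> sets M" using F(2) R_sets by blast
    have df: "disjoint_family_on (\<lambda>B. B) F" using F(3) by (simp add: disjoint_family_on_def disjoint_def)
    have "(\<Sum>B\<in>F. ennreal \<bar>\<nu> B\<bar>) \<le> (\<Sum>B\<in>F. emeasure P B + emeasure Q B)"
    proof (rule sum_mono)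
      fix B assume B: "B \<in> F"
      then have "B \<in> R" "B \<in> sets M" using F(2) FM by auto
      then have "ennreal (\<nu> B) \<le> emeasure P B" "ennreal (- \<nu> B) \<le> emeasure Q B"
        using pos_variation_upper[of B B] ideal_charge.pos_variation_upper[OF ideal_charge_uminus, of B B]
        by (auto simp: emeasure_P emeasure_Q)
      then show "ennreal \<bar>\<nu> B\<bar> \<le> emeasure P B + emeasure Q B"
        by (cases "0 \<le> \<nu> B") (auto intro: add_increasing add_increasing2)
    qed
    also have "\<dots> = emeasure P (\<Union>F) + emeasure Q (\<Union>F)"
      using sum_emeasure[of "\<lambda>B. B" F P, OF _ df F(1)] sum_emeasure[of "\<lambda>B. B" F Q, OF _ df F(1)] FM
      by (simp add: sum.distrib)
    also have "\<dots> \<le> emeasure P A + emeasure Q A"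
      using F(4) A by (intro add_mono emeasure_mono) auto
    finally show "(\<Sum>B\<in>F. ennreal \<bar>\<nu> B\<bar>) \<le> emeasure P A + emeasure Q A" .
  qed
next
  have up: "(\<Sum>B\<in>F. ennreal \<bar>\<nu> B\<bar>) \<le> variation R \<nu> A"
    if "finite F" "F \<subseteq> R" "disjoint F" "\<Union>F \<subseteq> A" for F
    unfolding variation_def by (rule SUP_upper) (use that in auto)
  have single: "ennreal \<bar>\<nu> B\<bar> \<le> variation R \<nu> A" if "B \<in> R" "B \<subseteq> A" for B
    using up[of "{B}"] that by simp
  show "emeasure P A + emeasure Q A \<le> variation R \<nu> A"
    unfolding emeasure_P[OF A] emeasure_Q[OF A] pos_variation_def
  proof (rule SUP_add_SUP_le)
    fix B C assume "B \<in> {B \<in> R. B \<subseteq> A}" "C \<in> {B \<in> R. B \<subseteq> A}"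
    then have B: "B \<in> R" "B \<subseteq> A" and C: "C \<in> R" "C \<subseteq> A" by auto
    consider "\<nu> B < 0" | "0 < \<nu> C" | "0 \<le> \<nu> B" "\<nu> C \<le> 0" by linarith
    then show "ennreal (\<nu> B) + ennreal (- \<nu> C) \<le> variation R \<nu> A"
    proof cases
      case 1
      then have "ennreal (\<nu> B) + ennreal (- \<nu> C) \<le> ennreal \<bar>\<nu> C\<bar>"
        by (simp add: ennreal_neg ennreal_leI)
      also have "\<dots> \<le> variation R \<nu> A" by (rule single[OF C])
      finally show ?thesis .
    next
      case 2
      then have "ennreal (\<nu> B) + ennreal (- \<nu> C) \<le> ennreal \<bar>\<nu> B\<bar>"
        by (simp add: ennreal_neg ennreal_leI)
      also have "\<dots> \<le> variation R \<nu> A" by (rule single[OF B])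
      finally show ?thesis .
    next
      case 3
      \<comment> \<open>The competitor B for P and the competitor C for Q may overlap. Their common
        part cancels in \<nu> B - \<nu> C, which leaves the disjoint sets B - C and C - B.\<close>
      have BC: "B - C \<in> R" "C - B \<in> R" "B \<inter> C \<in> R"
        using R_Diff[OF B(1) C(1)] R_Diff[OF C(1) B(1)] R_subset[OF B(1), of "B \<inter> C"]
          R_in_sets[OF B(1)] R_in_sets[OF C(1)] by auto
      have "B - B \<inter> C = B - C" "C - B \<inter> C = C - B" by auto
      then have e: "\<nu> B - \<nu> C = \<nu> (B - C) - \<nu> (C - B)"
        using diff[OF B(1) BC(3)] diff[OF C(1) BC(3)] by simp
      have "ennreal (\<nu> B) + ennreal (- \<nu> C) = ennreal (\<nu> B - \<nu> C)"
        using 3 by (simp flip: ennreal_plus)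
      also have "\<dots> \<le> ennreal \<bar>\<nu> (B - C)\<bar> + ennreal \<bar>\<nu> (C - B)\<bar>"
        unfolding e by (simp flip: ennreal_plus)
      also have "\<dots> \<le> variation R \<nu> A"
      \<comment> \<open>If the two sets coincide, the family {B - C, C - B} has one member and the
        sum over it one term; but then both sets are empty.\<close>
      proof (cases "B - C = C - B")
        case True
        then have "B - C = {}" "C - B = {}" by auto
        then show ?thesis by simp
      next
        case False
        then have "ennreal \<bar>\<nu> (B - C)\<bar> + ennreal \<bar>\<nu> (C - B)\<bar> = (\<Sum>B\<in>{B - C, C - B}. ennreal \<bar>\<nu> B\<bar>)"
          by simp
        also have "\<dots> \<le> variation R \<nu> A"
          by (rule up) (use BC B C in \<open>auto simp: disjoint_def\<close>)
        finally show ?thesis .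
      qed
      finally show ?thesis .
    qed
  qed (use R_empty in auto)
qed

lemma emeasure_V_variation: "A \<in> sets M \<Longrightarrow> emeasure V A = variation R \<nu> A"
  unfolding var_measure_def
proof (rule emeasure_measure_of_sigma)
  show "positive (sets M) (variation R \<nu>)" by (simp add: positive_def variation_eq)
  show "countably_additive (sets M) (variation R \<nu>)"
  proof (rule countably_additiveI)
    fix A :: "nat \<Rightarrow> 'a set"
    assume A: "range A \<subseteq> sets M" "disjoint_family A" "\<Union> (range A) \<in> sets M"
    then have "A i \<in> sets M" for i by auto
    then show "(\<Sum>i. variation R \<nu> (A i)) = variation R \<nu> (\<Union> (range A))"
      using A suminf_emeasure[of A P] suminf_emeasure[of A Q]
      by (simp add: variation_eq suminf_add[symmetric])
  qed
qed (rule sets.sigma_algebra_axioms)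

lemma emeasure_V: "A \<in> sets M \<Longrightarrow> emeasure V A = emeasure P A + emeasure Q A"
  by (simp add: emeasure_V_variation variation_eq)

lemma nn_integral_V:
  assumes "f \<in> borel_measurable M"
  shows "(\<integral>\<^sup>+x. f x \<partial>V) = (\<integral>\<^sup>+x. f x \<partial>P) + (\<integral>\<^sup>+x. f x \<partial>Q)"
  using assms
proof (induction f rule: borel_measurable_induct)
  case (cong f g)
  then show ?case by (simp cong: nn_integral_cong_simp)
next
  case (set A)
  then show ?case by (simp add: emeasure_V)
next
  case (mult u c)
  then show ?case by (simp add: nn_integral_cmult distrib_left)
next
  case (add u v)
  then show ?case by (simp add: nn_integral_add add_ac)
next
  case (seq U)
  have inc: "incseq (\<lambda>i. \<integral>\<^sup>+x. U i x \<partial>P)" "incseq (\<lambda>i. \<integral>\<^sup>+x. U i x \<partial>Q)"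
    using seq.hyps(3) by (auto simp: incseq_def le_fun_def intro!: nn_integral_mono)
  have m: "(\<integral>\<^sup>+x. (SUP i. U i) x \<partial>N) = (SUP i. \<integral>\<^sup>+x. U i x \<partial>N)" if "sets N = sets M" for N
  proof -
    have "U i \<in> borel_measurable N" for i
      using seq.hyps(1)[of i] by (simp add: measurable_cong_sets[OF that refl])
    then show ?thesis
      using nn_integral_monotone_convergence_SUP[OF seq.hyps(3), of N] by (simp add: image_comp)
  qed
  show ?case using seq.IH by (simp only: m sets_PQV ennreal_SUP_add[OF inc])
qed

lemma integrable_V_iff: "integrable V f \<longleftrightarrow> integrable P f \<and> integrable Q (f :: 'a \<Rightarrow> real)"
proof (cases "f \<in> borel_measurable M")
  case True
  then have "(\<integral>\<^sup>+x. ennreal (norm (f x)) \<partial>V) = (\<integral>\<^sup>+x. ennreal (norm (f x)) \<partial>P) + (\<integral>\<^sup>+x. ennreal (norm (f x)) \<partial>Q)"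
    by (intro nn_integral_V) measurable
  with True show ?thesis by (simp add: integrable_iff_bounded)
next
  case False
  then show ?thesis by (auto dest!: borel_measurable_integrable)
qed

end

subsection \<open>Functionals represented by charges\<close>

text \<open>Here \<phi> stands for a dual functional after U, and \<nu> for the same functional
  after m; they are tied together on indicators only. Order continuity of \<phi> comes later, since
  the bounds below are also applied to functions f outside D.\<close>

locale charge_functional = ideal_charge +
  fixes D :: "('a \<Rightarrow> real) set" and \<phi> :: "('a \<Rightarrow> real) \<Rightarrow> real"
  assumes D_add: "f \<in> D \<Longrightarrow> g \<in> D \<Longrightarrow> (\<lambda>x. f x + g x) \<in> D"
    and D_scale: "f \<in> D \<Longrightarrow> (\<lambda>x. c * f x) \<in> D"
    and D_ind: "A \<in> R \<Longrightarrow> indicator A \<in> D"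
    and lin: "linear_on D \<phi>"
    and \<phi>_ind: "A \<in> R \<Longrightarrow> \<phi> (indicator A) = \<nu> A"
begin

lemma \<phi>_add: "f \<in> D \<Longrightarrow> g \<in> D \<Longrightarrow> \<phi> (\<lambda>x. f x + g x) = \<phi> f + \<phi> g"
  using lin by (auto simp: linear_on_def)

lemma \<phi>_scale: "f \<in> D \<Longrightarrow> \<phi> (\<lambda>x. c * f x) = c * \<phi> f"
  using lin by (auto simp: linear_on_def)

lemma D_zero: "(\<lambda>x. 0) \<in> D"
  using D_scale[OF D_ind[OF R_empty], of 0] by simp

lemma D_diff: "f \<in> D \<Longrightarrow> g \<in> D \<Longrightarrow> (\<lambda>x. f x - g x) \<in> D"
  using D_add[of f "\<lambda>x. (-1) * g x"] D_scale[of g "-1"] by simp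

lemma \<phi>_diff: "f \<in> D \<Longrightarrow> g \<in> D \<Longrightarrow> \<phi> (\<lambda>x. f x - g x) = \<phi> f - \<phi> g"
  using \<phi>_add[of f "\<lambda>x. (-1) * g x"] D_scale[of g "-1"] \<phi>_scale[of g "-1"] by simp

lemma charge_functional_uminus: "charge_functional M R (\<lambda>B. - \<nu> B) D (\<lambda>f. - \<phi> f)"
proof -
  interpret neg: ideal_charge M R "\<lambda>B. - \<nu> B" by (rule ideal_charge_uminus)
  show ?thesis
    by unfold_locales (simp_all add: D_add D_scale D_ind linear_on_def \<phi>_add \<phi>_scale \<phi>_ind)
qed

text \<open>The bound f is \<open>ennreal\<close>-valued so that induction on nonnegative measurable
  functions can run over it. The order is pointwise on \<open>space M\<close> because \<phi> is not
  assumed to respect any null sets.\<close>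

definition minorants :: "('a \<Rightarrow> ennreal) \<Rightarrow> ('a \<Rightarrow> real) set" where
  "minorants f = {h \<in> D. \<forall>x\<in>space M. 0 \<le> h x \<and> ennreal (h x) \<le> f x}"

lemma zero_minorant: "(\<lambda>x. 0) \<in> minorants f"
  by (simp add: minorants_def D_zero)

text \<open>One half of the Riesz-Kantorovich formula for the positive part of \<open>\<phi>\<close>. Its right-hand side is
  superadditive, homogeneous and monotone in \<open>f\<close>, so that induction on \<open>f\<close> reduces it to
  indicator functions.\<close>

lemma nn_integral_P_le_SUP:
  assumes "f \<in> borel_measurable M"
  shows "(\<integral>\<^sup>+x. f x \<partial>P) \<le> (SUP h\<in>minorants f. ennreal (\<phi> h))"
  using assms
proof (induction f rule: borel_measurable_induct)
  case (cong f g)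
  have "minorants f = minorants g" using cong.hyps(3) by (auto simp: minorants_def)
  moreover have "(\<integral>\<^sup>+x. f x \<partial>P) = (\<integral>\<^sup>+x. g x \<partial>P)"
    by (rule nn_integral_cong) (use cong.hyps(3) in simp)
  ultimately show ?case using cong.IH by simp
next
  case (set A)
  have "(\<integral>\<^sup>+x. indicator A x \<partial>P) = pos_variation R \<nu> A" using set by (simp add: emeasure_P)
  also have "\<dots> \<le> (SUP h\<in>minorants (indicator A). ennreal (\<phi> h))"
    unfolding pos_variation_def
  proof (rule SUP_least)
    fix B assume B: "B \<in> {B \<in> R. B \<subseteq> A}"
    then have "indicator B \<in> minorants (indicator A)"
      by (auto simp: minorants_def D_ind indicator_def)
    moreover have "ennreal (\<nu> B) = ennreal (\<phi> (indicator B))" using B by (simp add: \<phi>_ind)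
    ultimately show "ennreal (\<nu> B) \<le> (SUP h\<in>minorants (indicator A). ennreal (\<phi> h))"
      by (simp only:) (rule SUP_upper)
  qed
  finally show ?case .
next
  case (mult u c)
  obtain r where r: "c = ennreal r" "0 \<le> r" using mult.hyps(1) by (cases c) auto
  have "(\<integral>\<^sup>+x. c * u x \<partial>P) \<le> c * (SUP h\<in>minorants u. ennreal (\<phi> h))"
    using mult by (simp add: nn_integral_cmult mult_left_mono)
  also have "\<dots> = (SUP h\<in>minorants u. c * ennreal (\<phi> h))" by (simp add: SUP_mult_left_ennreal)
  also have "\<dots> \<le> (SUP h\<in>minorants (\<lambda>x. c * u x). ennreal (\<phi> h))"
  proof (rule SUP_least)
    fix h assume h: "h \<in> minorants u"
    then have "(\<lambda>x. r * h x) \<in> minorants (\<lambda>x. c * u x)"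
      using r by (auto simp: minorants_def D_scale ennreal_mult mult_left_mono)
    moreover have "c * ennreal (\<phi> h) = ennreal (\<phi> (\<lambda>x. r * h x))"
      using h r by (simp add: minorants_def \<phi>_scale ennreal_mult')
    ultimately show "c * ennreal (\<phi> h) \<le> (SUP h\<in>minorants (\<lambda>x. c * u x). ennreal (\<phi> h))"
      by (simp only:) (rule SUP_upper)
  qed
  finally show ?case .
next
  case (add u v)
  have "(\<integral>\<^sup>+x. v x + u x \<partial>P) = (\<integral>\<^sup>+x. v x \<partial>P) + (\<integral>\<^sup>+x. u x \<partial>P)"
    by (rule nn_integral_add) (use add.hyps in simp_all)
  also have "\<dots> \<le> (SUP h\<in>minorants v. ennreal (\<phi> h)) + (SUP h\<in>minorants u. ennreal (\<phi> h))"
    by (rule add_mono) (use add.IH in simp_all)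
  also have "\<dots> \<le> (SUP h\<in>minorants (\<lambda>x. v x + u x). ennreal (\<phi> h))"
  proof (rule SUP_add_SUP_le)
    fix h k assume hk: "h \<in> minorants v" "k \<in> minorants u"
    have up: "ennreal (\<phi> g) \<le> (SUP h\<in>minorants (\<lambda>x. v x + u x). ennreal (\<phi> h))"
      if "g \<in> minorants (\<lambda>x. v x + u x)" for g
      by (rule SUP_upper[OF that])
    have m: "h \<in> minorants (\<lambda>x. v x + u x)" "k \<in> minorants (\<lambda>x. v x + u x)"
        "(\<lambda>x. h x + k x) \<in> minorants (\<lambda>x. v x + u x)"
      using hk by (auto simp: minorants_def D_add add_mono intro: add_increasing add_increasing2)
    consider "0 \<le> \<phi> h" "0 \<le> \<phi> k" | "\<phi> h < 0" | "\<phi> k < 0" by linarith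
    then show "ennreal (\<phi> h) + ennreal (\<phi> k) \<le> (SUP h\<in>minorants (\<lambda>x. v x + u x). ennreal (\<phi> h))"
    proof cases
      case 1
      then have "ennreal (\<phi> h) + ennreal (\<phi> k) = ennreal (\<phi> (\<lambda>x. h x + k x))"
        using hk by (simp add: minorants_def \<phi>_add)
      then show ?thesis using up[OF m(3)] by simp
    next
      case 2
      then show ?thesis using up[OF m(2)] by (simp add: ennreal_neg)
    next
      case 3
      then show ?thesis using up[OF m(1)] by (simp add: ennreal_neg)
    qed
  qed (use zero_minorant in auto)
  finally show ?case .
next
  case (seq U)
  have "(\<integral>\<^sup>+x. (SUP i. U i) x \<partial>P) = (SUP i. \<integral>\<^sup>+x. U i x \<partial>P)"
    using nn_integral_monotone_convergence_SUP[OF seq.hyps(3), of P] seq.hyps(1)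
    by (simp add: image_comp)
  also have "\<dots> \<le> (SUP h\<in>minorants (SUP i. U i). ennreal (\<phi> h))"
  proof (rule SUP_least)
    fix i
    have "minorants (U i) \<subseteq> minorants (SUP i. U i)"
      by (auto simp: minorants_def image_comp intro: SUP_upper2[of i])
    then show "(\<integral>\<^sup>+x. U i x \<partial>P) \<le> (SUP h\<in>minorants (SUP i. U i). ennreal (\<phi> h))"
      using seq.IH[of i] by (meson SUP_subset_mono order_refl order_trans)
  qed
  finally show ?case .
qed

lemma nn_integral_P_le:
  assumes f: "f \<in> borel_measurable M"
    and c: "\<And>h. h \<in> D \<Longrightarrow> (\<And>x. x \<in> space M \<Longrightarrow> \<bar>h x\<bar> \<le> \<bar>f x\<bar>) \<Longrightarrow> \<phi> h \<le> c"
  shows "(\<integral>\<^sup>+x. ennreal \<bar>f x\<bar> \<partial>P) \<le> ennreal c"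
proof -
  have "(\<integral>\<^sup>+x. ennreal \<bar>f x\<bar> \<partial>P) \<le> (SUP h\<in>minorants (\<lambda>x. ennreal \<bar>f x\<bar>). ennreal (\<phi> h))"
    by (rule nn_integral_P_le_SUP) (use f in measurable)
  also have "\<dots> \<le> ennreal c"
  proof (rule SUP_least)
    fix h assume h: "h \<in> minorants (\<lambda>x. ennreal \<bar>f x\<bar>)"
    have "\<bar>h x\<bar> \<le> \<bar>f x\<bar>" if "x \<in> space M" for x
      using h that by (simp add: minorants_def ennreal_le_iff)
    then show "ennreal (\<phi> h) \<le> ennreal c"
      using h by (intro ennreal_leI c) (simp_all add: minorants_def)
  qed
  finally show ?thesis .
qed

lemma nn_integral_Q_le:
  assumes f: "f \<in> borel_measurable M"
    and c: "\<And>h. h \<in> D \<Longrightarrow> (\<And>x. x \<in> space M \<Longrightarrow> \<bar>h x\<bar> \<le> \<bar>f x\<bar>) \<Longrightarrow> \<phi> h \<le> c"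
  shows "(\<integral>\<^sup>+x. ennreal \<bar>f x\<bar> \<partial>Q) \<le> ennreal c"
  unfolding Q_eq
proof (rule charge_functional.nn_integral_P_le[OF charge_functional_uminus f])
  fix h assume h: "h \<in> D" and le: "\<And>x. x \<in> space M \<Longrightarrow> \<bar>h x\<bar> \<le> \<bar>f x\<bar>"
  have "\<phi> (\<lambda>x. (-1) * h x) \<le> c" by (rule c) (use D_scale[OF h, of "-1"] le in auto)
  then show "- \<phi> h \<le> c" using \<phi>_scale[OF h, of "-1"] by simp
qed

text \<open>The factor 2 comes from estimating P and Q separately. It is harmless: the bound serves
  only to show finiteness, in one case uniformly over the dual ball.\<close>

lemma nn_integral_V_le:
  assumes f: "f \<in> borel_measurable M" and "0 \<le> c"
    and c: "\<And>h. h \<in> D \<Longrightarrow> (\<And>x. x \<in> space M \<Longrightarrow> \<bar>h x\<bar> \<le> \<bar>f x\<bar>) \<Longrightarrow> \<phi> h \<le> c"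
  shows "(\<integral>\<^sup>+x. ennreal \<bar>f x\<bar> \<partial>V) \<le> ennreal (2 * c)"
proof -
  have "(\<integral>\<^sup>+x. ennreal \<bar>f x\<bar> \<partial>V) = (\<integral>\<^sup>+x. ennreal \<bar>f x\<bar> \<partial>P) + (\<integral>\<^sup>+x. ennreal \<bar>f x\<bar> \<partial>Q)"
    by (rule nn_integral_V) (use f in measurable)
  also have "\<dots> \<le> ennreal c + ennreal c"
    by (intro add_mono nn_integral_P_le[OF f c] nn_integral_Q_le[OF f c])
  finally show ?thesis using \<open>0 \<le> c\<close> by (simp flip: ennreal_plus)
qed

end

text \<open>All order hypotheses refer to every point of \<open>space M\<close>. As assumptions they
  are weaker than their almost everywhere versions, and they keep the locale free of a reference
  measure.\<close>

locale order_continuous_functional = charge_functional +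
  assumes D_meas: "D \<subseteq> borel_measurable M"
    and D_solid: "f \<in> D \<Longrightarrow> g \<in> borel_measurable M \<Longrightarrow> (\<And>x. x \<in> space M \<Longrightarrow> \<bar>g x\<bar> \<le> \<bar>f x\<bar>) \<Longrightarrow> g \<in> D"
    and cover: "\<exists>\<Omega>::nat \<Rightarrow> 'a set. (\<forall>n. \<Omega> n \<in> R) \<and> (\<Union>n. \<Omega> n) = space M"
    and order_bounded: "f \<in> D \<Longrightarrow> \<exists>c. \<forall>h\<in>D. (\<forall>x\<in>space M. \<bar>h x\<bar> \<le> \<bar>f x\<bar>) \<longrightarrow> \<phi> h \<le> c"
    and order_continuous: "(\<And>n. s n \<in> D) \<Longrightarrow> (\<And>n x. x \<in> space M \<Longrightarrow> s (Suc n) x \<le> s n x) \<Longrightarrow>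
      (\<And>x. x \<in> space M \<Longrightarrow> (\<lambda>n. s n x) \<longlonglongrightarrow> 0) \<Longrightarrow> (\<lambda>n. \<phi> (s n)) \<longlonglongrightarrow> 0"
begin

lemma integrable_V: "f \<in> D \<Longrightarrow> integrable V f"
proof -
  assume f: "f \<in> D"
  then obtain c where c: "\<And>h. h \<in> D \<Longrightarrow> (\<And>x. x \<in> space M \<Longrightarrow> \<bar>h x\<bar> \<le> \<bar>f x\<bar>) \<Longrightarrow> \<phi> h \<le> c"
    using order_bounded[OF f] by metis
  have fm: "f \<in> borel_measurable M" using f D_meas by blast
  have "(\<integral>\<^sup>+x. ennreal \<bar>f x\<bar> \<partial>V) \<le> ennreal (2 * max 0 c)"
    by (rule nn_integral_V_le[OF fm]) (auto intro: max.coboundedI2 c)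
  also have "\<dots> < \<infinity>" by simp
  finally show ?thesis using fm by (auto simp: integrable_iff_bounded)
qed

lemma integrable_PQ:
  assumes "f \<in> D"
  shows "integrable P f" "integrable Q f"
  using integrable_V[OF assms] integrable_V_iff by auto

definition "\<psi> f = (\<integral>x. f x \<partial>P) - (\<integral>x. f x \<partial>Q)"

text \<open>Both sides pass to the same increasing limits: \<phi> by order continuity along f - s n,
  which decreases to 0, and \<psi> by dominated convergence with majorant f.\<close>

lemma \<phi>_eq_\<psi>_limit:
  assumes f: "f \<in> D" and s: "\<And>n. s n \<in> D" "\<And>n x. x \<in> space M \<Longrightarrow> 0 \<le> s n x"
    "\<And>n x. x \<in> space M \<Longrightarrow> s n x \<le> s (Suc n) x" "\<And>n x. x \<in> space M \<Longrightarrow> s n x \<le> f x"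
    "\<And>x. x \<in> space M \<Longrightarrow> (\<lambda>n. s n x) \<longlonglongrightarrow> f x"
    and eq: "\<And>n. \<phi> (s n) = \<psi> (s n)"
  shows "\<phi> f = \<psi> f"
proof -
  have "(\<lambda>n. \<phi> (\<lambda>x. f x - s n x)) \<longlonglongrightarrow> 0"
  proof (rule order_continuous)
    fix x assume "x \<in> space M"
    from tendsto_diff[OF tendsto_const s(5)[OF this], of "f x"]
    show "(\<lambda>n. f x - s n x) \<longlonglongrightarrow> 0" by simp
  qed (use s(3) D_diff[OF f s(1)] in auto)
  then have "(\<lambda>n. \<phi> f - (\<phi> f - \<phi> (s n))) \<longlonglongrightarrow> \<phi> f - 0"
    by (intro tendsto_diff tendsto_const) (simp add: \<phi>_diff[OF f s(1)])
  then have 1: "(\<lambda>n. \<phi> (s n)) \<longlonglongrightarrow> \<phi> f" by simp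
  have lim: "(\<lambda>n. \<integral>x. s n x \<partial>N) \<longlonglongrightarrow> (\<integral>x. f x \<partial>N)"
    if "sets N = sets M" "integrable N f" for N
  proof (rule integral_dominated_convergence[where w = "f"])
    have sp: "space N = space M" by (rule sets_eq_imp_space_eq[OF that(1)])
    show "f \<in> borel_measurable N" using that(2) by (rule borel_measurable_integrable)
    show "s n \<in> borel_measurable N" for n
      using s(1)[of n] D_meas by (auto simp: measurable_cong_sets[OF that(1) refl])
    show "AE x in N. (\<lambda>n. s n x) \<longlonglongrightarrow> f x" by (rule AE_I2) (use s(5) sp in simp)
    show "AE x in N. norm (s n x) \<le> f x" for n by (rule AE_I2) (use s(2,4) sp in auto)
  qed (rule that(2))
  have "(\<lambda>n. \<psi> (s n)) \<longlonglongrightarrow> \<psi> f"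
    unfolding \<psi>_def by (intro tendsto_diff lim integrable_PQ[OF f]) simp_all
  with 1 show ?thesis using LIMSEQ_unique by (auto simp: eq)
qed

text \<open>Membership in D stays a premise within the induction, since D need not contain all
  nonnegative functions. The building blocks of a member of D are recovered in D by scaling and
  solidity.\<close>

lemma \<phi>_eq_\<psi>_nonneg:
  assumes "f \<in> borel_measurable M" "\<And>x. 0 \<le> f x"
  shows "f \<in> D \<longrightarrow> \<phi> f = \<psi> f"
  using assms
proof (induction rule: borel_measurable_induct_real)
  case (set A)
  show ?case
  proof
    assume AD: "indicator A \<in> D"
    obtain \<Omega> :: "nat \<Rightarrow> 'a set" where \<Omega>: "\<And>n. \<Omega> n \<in> R" "(\<Union>n. \<Omega> n) = space M"
      using cover by blast
    \<comment> \<open>That \<open>indicator A\<close> lies in D does not put A into R, as D may be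
      larger than X. The truncations by the covering sets are in R and exhaust A.\<close>
    let ?A = "\<lambda>n. A \<inter> (\<Union>i<n. \<Omega> i)"
    have AR: "?A n \<in> R" for n
      by (rule R_subset[OF R_UN[OF \<Omega>(1), where n = n]]) (use set R_in_sets[OF R_UN[OF \<Omega>(1), where n = n]] in auto)
    show "\<phi> (indicator A) = \<psi> (indicator A)"
    proof (rule \<phi>_eq_\<psi>_limit[OF AD, where s = "\<lambda>n. indicator (?A n)"])
      fix n
      show "indicator (?A n) \<in> D" by (rule D_ind[OF AR])
      have "\<psi> (indicator (?A n)) = \<nu> (?A n)"
        using jordan_decomposition[OF AR, of n] R_in_sets[OF AR, of n] sets.sets_into_space[OF R_in_sets[OF AR, of n]]
        by (simp add: \<psi>_def Int_absorb2)
      then show "\<phi> (indicator (?A n)) = \<psi> (indicator (?A n))" by (simp add: \<phi>_ind[OF AR])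
    next
      fix x assume "x \<in> space M"
      then obtain k where k: "x \<in> \<Omega> k" using \<Omega>(2) by blast
      have "indicator (?A n) x = (indicator A x :: real)" if "Suc k \<le> n" for n
        using k that by (auto simp: indicator_def)
      then show "(\<lambda>n. indicator (?A n) x :: real) \<longlonglongrightarrow> indicator A x"
        by (intro tendsto_eventually eventually_sequentiallyI[of "Suc k"]) auto
    qed (auto simp: indicator_def less_Suc_eq)
  qed
next
  case (mult u c)
  show ?case
  proof
    assume cu: "(\<lambda>x. c * u x) \<in> D"
    show "\<phi> (\<lambda>x. c * u x) = \<psi> (\<lambda>x. c * u x)"
    \<comment> \<open>For c = 0 the function u may lie outside D, so the induction hypothesis says
      nothing about it.\<close>
    proof (cases "c = 0")
      case True
      then show ?thesis using \<phi>_scale[OF D_zero, of 0] by (simp add: \<psi>_def)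
    next
      case False
      then have "u \<in> D" using D_scale[OF cu, of "1 / c"] by simp
      then show ?thesis using mult.IH by (simp add: \<phi>_scale \<psi>_def right_diff_distrib)
    qed
  qed
next
  case (add u v)
  show ?case
  proof
    assume D: "(\<lambda>x. v x + u x) \<in> D"
    have uv: "u \<in> D" "v \<in> D"
      using add.hyps by (auto intro!: D_solid[OF D])
    then show "\<phi> (\<lambda>x. v x + u x) = \<psi> (\<lambda>x. v x + u x)"
      using add.IH integrable_PQ[OF uv(1)] integrable_PQ[OF uv(2)] by (simp add: \<phi>_add \<psi>_def)
  qed
next
  case (seq U)
  show ?case
  proof
    assume f: "f \<in> D"
    have le: "U n x \<le> f x" if "x \<in> space M" for n x
      using seq.hyps(3) seq.hyps(4)[OF that] by (intro incseq_le) (auto simp: incseq_def le_fun_def)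
    have UD: "U n \<in> D" for n
      by (rule D_solid[OF f seq.hyps(1)]) (use le[of _ n] seq.hyps(2)[of n] in \<open>fastforce intro: order_trans[OF _ abs_ge_self]\<close>)
    show "\<phi> f = \<psi> f"
      by (rule \<phi>_eq_\<psi>_limit[OF f, where s = U]) (use seq UD le in \<open>auto simp: incseq_Suc_iff le_fun_def\<close>)
  qed
qed

lemma \<phi>_eq_\<psi>: 
  assumes f: "f \<in> D"
  shows "\<phi> f = \<psi> f"
proof -
  have fm: "f \<in> borel_measurable M" using f D_meas by blast
  let ?p = "\<lambda>x. max 0 (f x)" and ?n = "\<lambda>x. max 0 (- f x)"
  have pm: "?p \<in> borel_measurable M" "?n \<in> borel_measurable M" using fm by auto
  have D: "?p \<in> D" "?n \<in> D" by (auto intro!: D_solid[OF f] pm)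
  have e: "f = (\<lambda>x. ?p x - ?n x)" by (auto simp: max_def)
  have "\<phi> f = \<psi> ?p - \<psi> ?n"
    using \<phi>_diff[OF D] \<phi>_eq_\<psi>_nonneg[OF pm(1)] \<phi>_eq_\<psi>_nonneg[OF pm(2)] D by (subst e) simp
  also have "\<dots> = \<psi> (\<lambda>x. ?p x - ?n x)"
    unfolding \<psi>_def using integrable_PQ[OF D(1)] integrable_PQ[OF D(2)] by (simp add: Bochner_Integration.integral_diff)
  finally show ?thesis using e by simp
qed

text \<open>For \<phi> = xs o U this identifies the vector that \<open>vm_L1\<close> demands for the
  set A: it is U applied to the restriction of f to A, for all xs at once.\<close>

lemma scalar_int_eq:
  assumes f: "f \<in> D" and A: "A \<in> sets M"
  shows "scalar_int M R \<nu> A f = \<phi> (\<lambda>x. indicator A x * f x)"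
proof -
  have "(\<lambda>x. indicator A x * f x) \<in> borel_measurable M" using f D_meas A by auto
  then have "(\<lambda>x. indicator A x * f x) \<in> D"
    by (rule D_solid[OF f]) (simp add: indicator_def)
  then show ?thesis by (simp add: \<phi>_eq_\<psi> scalar_int_def \<psi>_def)
qed

end

subsection \<open>Integration with respect to vector charges\<close>

lemma dual_ball_linear: "f \<in> dual_ball \<Longrightarrow> linear f"
  by (simp add: dual_ball_iff)

lemma dual_ball_le_norm: "f \<in> dual_ball \<Longrightarrow> \<bar>f x\<bar> \<le> norm x"
  by (simp add: dual_ball_iff)

lemma dual_ball_tendsto: "f \<in> dual_ball \<Longrightarrow> (s \<longlongrightarrow> l) F \<Longrightarrow> ((\<lambda>n. f (s n)) \<longlongrightarrow> f l) F"
  by (auto simp: dual_ball_def intro: bounded_linear.tendsto)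

text \<open>The vector charge enters through its scalar versions only; the norm of E comes back
  through norming functionals.\<close>

locale vector_charge =
  fixes M :: "'a measure" and R :: "'a set set" and m :: "'a set \<Rightarrow> 'b::banach"
  assumes charge: "xs \<in> dual_ball \<Longrightarrow> ideal_charge M R (\<lambda>B. xs (m B))"
begin

abbreviation "Pm xs \<equiv> pos_measure M R (\<lambda>B. xs (m B))"
abbreviation "Qm xs \<equiv> neg_measure M R (\<lambda>B. xs (m B))"
abbreviation "Vm xs \<equiv> var_measure M R (\<lambda>B. xs (m B))"
abbreviation "L1 \<equiv> vm_L1 M R m"
abbreviation "sint xs \<equiv> scalar_int M R (\<lambda>B. xs (m B))"
abbreviation "C \<equiv> ctrl_measure M R m"

lemma vm_null_iff: "vm_null M R m A \<longleftrightarrow> A \<in> sets M \<and> (\<forall>xs\<in>dual_ball. emeasure (Vm xs) A = 0)"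
  using ideal_charge.emeasure_V_variation[OF charge] by (auto simp: vm_null_def)

text \<open>For a set function with values 0 and \<infinity>, countable additivity says that a
  countable union is null exactly when each member is.\<close>

lemma emeasure_ctrl:
  assumes "A \<in> sets M"
  shows "emeasure C A = (if vm_null M R m A then 0 else \<infinity>)"
  unfolding ctrl_measure_def
proof (rule emeasure_measure_of_sigma)
  show "positive (sets M) (\<lambda>A. if vm_null M R m A then 0 else \<infinity>)"
    by (simp add: positive_def vm_null_iff)
  show "countably_additive (sets M) (\<lambda>A. if vm_null M R m A then 0 else \<infinity>)"
  proof (rule countably_additiveI)
    fix A :: "nat \<Rightarrow> 'a set"
    assume A: "range A \<subseteq> sets M" "disjoint_family A" "\<Union> (range A) \<in> sets M"
    then have Ai: "A i \<in> sets M" for i by auto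
    show "(\<Sum>i. if vm_null M R m (A i) then 0 else \<infinity>) = (if vm_null M R m (\<Union> (range A)) then 0 else \<infinity> :: ennreal)"
    proof (cases "\<forall>i. vm_null M R m (A i)")
      case True
      have "emeasure (Vm xs) (\<Union> (range A)) = 0" if "xs \<in> dual_ball" for xs
        by (rule emeasure_UN_eq_0)
          (use True that Ai ideal_charge.sets_PQV[OF charge[OF that]] in \<open>auto simp: vm_null_iff\<close>)
      then have "vm_null M R m (\<Union> (range A))" using A(3) by (simp add: vm_null_iff)
      with True show ?thesis by simp
    next
      case False
      then obtain i where i: "\<not> vm_null M R m (A i)" by blast
      then obtain xs where xs: "xs \<in> dual_ball" "emeasure (Vm xs) (A i) \<noteq> 0"
        using Ai by (auto simp: vm_null_iff)
      have "emeasure (Vm xs) (A i) \<le> emeasure (Vm xs) (\<Union> (range A))"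
        by (rule emeasure_mono) (use A(3) ideal_charge.sets_PQV[OF charge[OF xs(1)]] in auto)
      then have "\<not> vm_null M R m (\<Union> (range A))" using xs by (auto simp: vm_null_iff intro!: bexI[of _ xs])
      moreover have "(\<Sum>i. if vm_null M R m (A i) then 0 else \<infinity> :: ennreal) = \<infinity>"
      proof -
        have "(\<Sum>j\<in>{i}. if vm_null M R m (A j) then 0 else \<infinity> :: ennreal)
            \<le> (\<Sum>i. if vm_null M R m (A i) then 0 else \<infinity>)"
          by (rule sum_le_suminf) auto
        then show ?thesis using i by (simp add: top_unique)
      qed
      ultimately show ?thesis by simp
    qed
  qed
qed (use assms sets.sigma_algebra_axioms in auto)

lemma sets_C [simp, measurable_cong]: "sets C = sets M"
  by (simp add: ctrl_measure_def)

lemma space_C [simp]: "space C = space M"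
  by (simp add: ctrl_measure_def)

lemma null_sets_C: "A \<in> null_sets C \<longleftrightarrow> vm_null M R m A"
proof
  assume "A \<in> null_sets C"
  then show "vm_null M R m A" using emeasure_ctrl[of A] by (auto simp: null_sets_def split: if_splits)
next
  assume "vm_null M R m A"
  then show "A \<in> null_sets C" using emeasure_ctrl[of A] by (auto simp: null_sets_def vm_null_iff)
qed

lemma AE_C_imp:
  assumes ae: "AE x in C. Pr x" and xs: "xs \<in> dual_ball"
  shows "AE x in Pm xs. Pr x" "AE x in Qm xs. Pr x"
proof -
  interpret ideal_charge M R "\<lambda>B. xs (m B)" by (rule charge[OF xs])
  obtain N where N: "N \<in> null_sets C" "{x\<in>space C. \<not> Pr x} \<subseteq> N"
    using ae by (auto simp: eventually_ae_filter)
  have "N \<in> sets M" "emeasure V N = 0" using N(1) xs by (auto simp: null_sets_C vm_null_iff)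
  then have "N \<in> null_sets P" "N \<in> null_sets Q" by (auto simp: null_sets_def emeasure_V)
  then show "AE x in P. Pr x" "AE x in Q. Pr x" using N(2) by (auto intro!: AE_I'[of N])
qed

lemma vm_L1I:
  assumes "f \<in> borel_measurable M" "\<And>xs. xs \<in> dual_ball \<Longrightarrow> integrable (Vm xs) f"
    "\<And>A. A \<in> sets M \<Longrightarrow> \<exists>v. \<forall>xs\<in>dual_ball. xs v = sint xs A f"
  shows "f \<in> L1"
  using assms by (simp add: vm_L1_def)

lemma vm_L1D:
  assumes "f \<in> L1"
  shows "f \<in> borel_measurable M" "\<And>xs. xs \<in> dual_ball \<Longrightarrow> integrable (Vm xs) f"
    "\<And>A. A \<in> sets M \<Longrightarrow> \<exists>v. \<forall>xs\<in>dual_ball. xs v = sint xs A f"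
  using assms by (auto simp: vm_L1_def)

lemma integrable_PQm:
  assumes "integrable (Vm xs) f" "xs \<in> dual_ball" "A \<in> sets M"
  shows "integrable (Pm xs) (\<lambda>x. indicator A x * f x)" "integrable (Qm xs) (\<lambda>x. indicator A x * f x :: real)"
proof -
  interpret ideal_charge M R "\<lambda>B. xs (m B)" by (rule charge[OF assms(2)])
  show "integrable P (\<lambda>x. indicator A x * f x)" "integrable Q (\<lambda>x. indicator A x * f x)"
    using assms(1,3) integrable_V_iff integrable_real_mult_indicator[of A P f] integrable_real_mult_indicator[of A Q f]
    by (simp_all add: mult.commute)
qed

lemma sint_add:
  assumes "f \<in> L1" "g \<in> L1" "xs \<in> dual_ball" "A \<in> sets M"
  shows "sint xs A (\<lambda>x. f x + g x) = sint xs A f + sint xs A g"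
  using integrable_PQm[OF vm_L1D(2)[OF assms(1,3)] assms(3,4)]
    integrable_PQm[OF vm_L1D(2)[OF assms(2,3)] assms(3,4)]
  by (simp add: scalar_int_def distrib_left)

lemma sint_scale: "sint xs A (\<lambda>x. c * f x) = c * sint xs A f"
  by (simp add: scalar_int_def mult.left_commute[of _ c] right_diff_distrib)

lemma vm_L1_add:
  assumes f: "f \<in> L1" and g: "g \<in> L1"
  shows "(\<lambda>x. f x + g x) \<in> L1"
proof (rule vm_L1I)
  fix A assume A: "A \<in> sets M"
  obtain v w where "\<forall>xs\<in>dual_ball. xs v = sint xs A f" "\<forall>xs\<in>dual_ball. xs w = sint xs A g"
    using vm_L1D(3)[OF f A] vm_L1D(3)[OF g A] by blast
  then show "\<exists>v. \<forall>xs\<in>dual_ball. xs v = sint xs A (\<lambda>x. f x + g x)"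
    using sint_add[OF f g _ A] by (intro exI[of _ "v + w"]) (simp add: linear_add[OF dual_ball_linear])
qed (use vm_L1D(1,2)[OF f] vm_L1D(1,2)[OF g] in auto)

lemma vm_L1_scale:
  assumes f: "f \<in> L1"
  shows "(\<lambda>x. c * f x) \<in> L1"
proof (rule vm_L1I)
  fix A assume A: "A \<in> sets M"
  obtain v where "\<forall>xs\<in>dual_ball. xs v = sint xs A f"
    using vm_L1D(3)[OF f A] by blast
  then show "\<exists>v. \<forall>xs\<in>dual_ball. xs v = sint xs A (\<lambda>x. c * f x)"
    by (intro exI[of _ "c *\<^sub>R v"]) (simp add: sint_scale linear_scale[OF dual_ball_linear])
qed (use vm_L1D(1,2)[OF f] in auto)

lemma vm_L1_diff: "f \<in> L1 \<Longrightarrow> g \<in> L1 \<Longrightarrow> (\<lambda>x. f x - g x) \<in> L1"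
  using vm_L1_add[of f "\<lambda>x. (-1) * g x"] vm_L1_scale[of g "-1"] by simp

lemma vm_L1_zero: "(\<lambda>x. 0) \<in> L1"
proof (rule vm_L1I)
  fix A
  show "\<exists>v. \<forall>xs\<in>dual_ball. xs v = sint xs A (\<lambda>x. 0)"
    by (intro exI[of _ 0]) (simp add: scalar_int_def linear_0[OF dual_ball_linear])
qed simp_all

lemma vm_L1_sum: "(\<And>i. i \<in> I \<Longrightarrow> f i \<in> L1) \<Longrightarrow> (\<lambda>x. \<Sum>i\<in>I. f i x) \<in> L1"
  by (induction I rule: infinite_finite_induct) (simp_all add: vm_L1_zero vm_L1_add)

lemma sint_indicator: "sint xs A (\<lambda>x. indicator B x * f x) = sint xs (A \<inter> B) f"
  by (simp add: scalar_int_def indicator_inter_arith mult.assoc)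

text \<open>Integrating the restriction over A is integrating f over A \<inter> B, and the
  definition of L1 provides a vector for every measurable set.\<close>

lemma vm_L1_indicator:
  assumes f: "f \<in> L1" and B: "B \<in> sets M"
  shows "(\<lambda>x. indicator B x * f x) \<in> L1"
proof (rule vm_L1I)
  fix xs :: "'b \<Rightarrow> real" assume xs: "xs \<in> dual_ball"
  then interpret ideal_charge M R "\<lambda>B. xs (m B)" by (rule charge)
  show "integrable V (\<lambda>x. indicator B x * f x)"
    using vm_L1D(2)[OF f xs] integrable_PQm[OF _ xs B] integrable_V_iff by blast
next
  fix A assume "A \<in> sets M"
  then have "A \<inter> B \<in> sets M" using B by auto
  from vm_L1D(3)[OF f this] show "\<exists>v. \<forall>xs\<in>dual_ball. xs v = sint xs A (\<lambda>x. indicator B x * f x)"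
    by (simp add: sint_indicator)
qed (use vm_L1D(1)[OF f] B in auto)

lemma vm_L1_cong_AE:
  assumes f: "f \<in> L1" and g: "g \<in> borel_measurable M" and ae: "AE x in C. f x = g x"
  shows "g \<in> L1" and "xs \<in> dual_ball \<Longrightarrow> A \<in> sets M \<Longrightarrow> sint xs A g = sint xs A f"
proof -
  have *: "integrable (Vm xs) g \<and> (\<forall>A\<in>sets M. sint xs A g = sint xs A f)" if xs: "xs \<in> dual_ball" for xs
  proof -
    interpret ideal_charge M R "\<lambda>B. xs (m B)" by (rule charge[OF xs])
    have fi: "integrable P f" "integrable Q f" using vm_L1D(2)[OF f xs] integrable_V_iff by auto
    have fm: "f \<in> borel_measurable M" by (rule vm_L1D(1)[OF f])
    have "integrable P g" "integrable Q g"
      using fi AE_C_imp[OF ae xs] fm g integrable_cong_AE[of f P g] integrable_cong_AE[of f Q g]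
      by simp_all
    moreover have "sint xs A g = sint xs A f" if "A \<in> sets M" for A
      unfolding scalar_int_def using AE_C_imp[OF ae xs] fm g that
      by (intro arg_cong2[where f = minus] integral_cong_AE) auto
    ultimately show ?thesis using integrable_V_iff by blast
  qed
  show "g \<in> L1"
    by (rule vm_L1I[OF g]) (use * vm_L1D(3)[OF f] in \<open>simp_all\<close>)
  show "xs \<in> dual_ball \<Longrightarrow> A \<in> sets M \<Longrightarrow> sint xs A g = sint xs A f" using * by blast
qed

lemma vm_L1_abs_iff:
  assumes fm: "f \<in> borel_measurable M"
  shows "(\<lambda>x. \<bar>f x\<bar>) \<in> L1 \<longleftrightarrow> f \<in> L1"
proof -
  let ?B = "{x \<in> space M. 0 \<le> f x}" and ?B' = "{x \<in> space M. f x < 0}"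
  have B: "?B \<in> sets M" "?B' \<in> sets M" using fm by auto
  have "(\<lambda>x. indicator ?B x * g x + (-1) * (indicator ?B' x * g x)) \<in> L1" if "g \<in> L1" for g
    by (intro vm_L1_add vm_L1_scale vm_L1_indicator B that)
  moreover have "h \<in> L1" if "g \<in> L1" "h \<in> borel_measurable M" "\<And>x. x \<in> space M \<Longrightarrow> g x = h x" for g h
    by (rule vm_L1_cong_AE(1)[OF that(1,2)]) (use that(3) in \<open>auto intro: AE_I2\<close>)
  ultimately have *: "h \<in> L1" if "g \<in> L1" "h \<in> borel_measurable M"
      "\<And>x. x \<in> space M \<Longrightarrow> indicator ?B x * g x + (-1) * (indicator ?B' x * g x) = h x" for g h
    using that by blast
  show ?thesis
  proof
    assume "(\<lambda>x. \<bar>f x\<bar>) \<in> L1"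
    then show "f \<in> L1" by (rule *) (use fm in \<open>auto simp: indicator_def\<close>)
  next
    assume "f \<in> L1"
    then show "(\<lambda>x. \<bar>f x\<bar>) \<in> L1" by (rule *) (use fm in \<open>auto simp: indicator_def\<close>)
  qed
qed

lemma vm_int_eqI:
  assumes "\<And>xs. xs \<in> dual_ball \<Longrightarrow> xs v = sint xs (space M) f"
  shows "vm_int M R m f = v"
  unfolding vm_int_def
proof (rule some_equality)
  fix w assume w: "\<forall>xs\<in>dual_ball. xs w = sint xs (space M) f"
  show "w = v"
  proof (rule dual_ball_eqI)
    fix xs :: "'b \<Rightarrow> real" assume xs: "xs \<in> dual_ball"
    then show "xs w = xs v" using w by (simp add: assms)
  qed
qed (intro ballI assms)

lemma vm_int:
  assumes "f \<in> L1" "xs \<in> dual_ball"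
  shows "xs (vm_int M R m f) = sint xs (space M) f"
proof -
  obtain v where v: "\<And>xs. xs \<in> dual_ball \<Longrightarrow> xs v = sint xs (space M) f"
    using vm_L1D(3)[OF assms(1) sets.top] by blast
  then show ?thesis using vm_int_eqI[OF v] assms(2) by simp
qed

lemma vm_int_add:
  "f \<in> L1 \<Longrightarrow> g \<in> L1 \<Longrightarrow> vm_int M R m (\<lambda>x. f x + g x) = vm_int M R m f + vm_int M R m g"
  by (rule vm_int_eqI) (simp add: linear_add[OF dual_ball_linear] vm_int sint_add)

lemma vm_int_scale: "f \<in> L1 \<Longrightarrow> vm_int M R m (\<lambda>x. c * f x) = c *\<^sub>R vm_int M R m f"
  by (rule vm_int_eqI) (simp add: linear_scale[OF dual_ball_linear] vm_int sint_scale)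

lemma vm_int_diff:
  "f \<in> L1 \<Longrightarrow> g \<in> L1 \<Longrightarrow> vm_int M R m (\<lambda>x. f x - g x) = vm_int M R m f - vm_int M R m g"
  using vm_int_add[of f "\<lambda>x. (-1) * g x"] vm_L1_scale[of g "-1"] vm_int_scale[of g "-1"] by simp

lemma vm_int_cong_AE:
  assumes "f \<in> L1" "g \<in> borel_measurable M" "AE x in C. f x = g x"
  shows "vm_int M R m g = vm_int M R m f"
  by (rule vm_int_eqI) (use vm_int[OF assms(1)] vm_L1_cong_AE(2)[OF assms] in simp)

end

section \<open>Powers, the L1-norm, and solidity of L1\<close>

lemma abs_add_powr_le:
  fixes a b q :: real
  assumes "0 < q"
  shows "\<bar>a + b\<bar> powr q \<le> 2 powr q * (\<bar>a\<bar> powr q + \<bar>b\<bar> powr q)"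
proof -
  \<comment> \<open>Going through the maximum treats q < 1 and q > 1 alike, without
    convexity.\<close>
  have "\<bar>a + b\<bar> powr q \<le> (2 * max \<bar>a\<bar> \<bar>b\<bar>) powr q"
    by (rule powr_mono2) (use assms in auto)
  also have "\<dots> = 2 powr q * (max \<bar>a\<bar> \<bar>b\<bar> powr q)" by (simp add: powr_mult)
  also have "\<dots> \<le> 2 powr q * (\<bar>a\<bar> powr q + \<bar>b\<bar> powr q)"
    by (rule mult_left_mono) (auto simp: max_def)
  finally show ?thesis .
qed

text \<open>\<open>enn2real\<close> sends an infinite supremum to 0, so \<open>vm_L1_norm\<close>
  dominates the scalar integrals only once the supremum is known to be finite.\<close>

locale bounded_vector_charge = vector_charge +
  assumes L1_bounded: "f \<in> vm_L1 M R m \<Longrightarrow>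
    \<exists>c. \<forall>xs\<in>dual_ball. (\<integral>\<^sup>+x. ennreal \<bar>f x\<bar> \<partial>var_measure M R (\<lambda>B. xs (m B))) \<le> ennreal c"
begin

abbreviation "N1 \<equiv> vm_L1_norm M R m"

lemma nn_integral_le_N1:
  assumes "f \<in> L1" "xs \<in> dual_ball"
  shows "(\<integral>\<^sup>+x. ennreal \<bar>f x\<bar> \<partial>Vm xs) \<le> ennreal (N1 f)"
proof -
  let ?S = "SUP xs\<in>dual_ball. \<integral>\<^sup>+x. ennreal \<bar>f x\<bar> \<partial>Vm xs"
  obtain c where "\<forall>xs\<in>dual_ball. (\<integral>\<^sup>+x. ennreal \<bar>f x\<bar> \<partial>Vm xs) \<le> ennreal c"
    using L1_bounded[OF assms(1)] by blast
  then have "?S \<le> ennreal c" by (intro SUP_least) auto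
  then have "?S < \<infinity>" by (auto intro: le_less_trans)
  then have "ennreal (N1 f) = ?S" by (simp add: vm_L1_norm_def)
  then show ?thesis using SUP_upper[OF assms(2), of "\<lambda>xs. \<integral>\<^sup>+x. ennreal \<bar>f x\<bar> \<partial>Vm xs"] by simp
qed

lemma N1_nonneg: "0 \<le> N1 f"
  by (simp add: vm_L1_norm_def)

lemma N1_abs: "N1 (\<lambda>x. \<bar>f x\<bar>) = N1 f"
  by (simp add: vm_L1_norm_def)

lemma norm_vm_int_le_nn_integral:
  assumes f: "f \<in> L1" and c: "0 \<le> c"
    "\<And>xs. xs \<in> dual_ball \<Longrightarrow> (\<integral>\<^sup>+x. ennreal \<bar>f x\<bar> \<partial>Vm xs) \<le> ennreal c"
  shows "norm (vm_int M R m f) \<le> c"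
proof -
  obtain xs where xs: "xs \<in> dual_ball" "xs (vm_int M R m f) = norm (vm_int M R m f)"
    using exists_norming_functional by blast
  interpret ideal_charge M R "\<lambda>B. xs (m B)" by (rule charge[OF xs(1)])
  have i: "integrable P f" "integrable Q f" using vm_L1D(2)[OF f xs(1)] integrable_V_iff by auto
  have fm: "f \<in> borel_measurable M" by (rule vm_L1D(1)[OF f])
  have s: "sint xs (space M) f = (\<integral>x. f x \<partial>P) - (\<integral>x. f x \<partial>Q)"
    unfolding scalar_int_def
    by (intro arg_cong2[where f = minus] Bochner_Integration.integral_cong) auto
  have "norm (vm_int M R m f) \<le> (\<integral>x. \<bar>f x\<bar> \<partial>P) + (\<integral>x. \<bar>f x\<bar> \<partial>Q)"
    using integral_abs_bound[of P f] integral_abs_bound[of Q f] vm_int[OF f xs(1)] xs(2) s by linarith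
  then have "ennreal (norm (vm_int M R m f)) \<le> ennreal ((\<integral>x. \<bar>f x\<bar> \<partial>P) + (\<integral>x. \<bar>f x\<bar> \<partial>Q))"
    by (rule ennreal_leI)
  also have "\<dots> = (\<integral>\<^sup>+x. ennreal \<bar>f x\<bar> \<partial>P) + (\<integral>\<^sup>+x. ennreal \<bar>f x\<bar> \<partial>Q)"
    using i by (simp add: nn_integral_eq_integral integrable_abs)
  also have "\<dots> = (\<integral>\<^sup>+x. ennreal \<bar>f x\<bar> \<partial>V)"
    by (rule nn_integral_V[symmetric]) (use fm in measurable)
  also have "\<dots> \<le> ennreal c" by (rule c(2)[OF xs(1)])
  finally show ?thesis using c(1) by (simp add: ennreal_le_iff)
qed

lemma norm_vm_int_le: "f \<in> L1 \<Longrightarrow> norm (vm_int M R m f) \<le> N1 f"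
  by (rule norm_vm_int_le_nn_integral[OF _ N1_nonneg nn_integral_le_N1])

lemma norm_vm_int_le_scaled:
  assumes "f \<in> L1" "h \<in> L1" "0 \<le> c" "\<And>x. x \<in> space M \<Longrightarrow> \<bar>h x\<bar> \<le> c * \<bar>f x\<bar>"
  shows "norm (vm_int M R m h) \<le> c * N1 f"
proof (rule norm_vm_int_le_nn_integral[OF assms(2)])
  fix xs :: "'b \<Rightarrow> real" assume xs: "xs \<in> dual_ball"
  then interpret ideal_charge M R "\<lambda>B. xs (m B)" by (rule charge)
  have "(\<integral>\<^sup>+x. ennreal \<bar>h x\<bar> \<partial>V) \<le> (\<integral>\<^sup>+x. ennreal c * ennreal \<bar>f x\<bar> \<partial>V)"
    by (rule nn_integral_mono) (use assms(3,4) in \<open>simp add: ennreal_mult'[symmetric] ennreal_leI\<close>)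
  also have "\<dots> = ennreal c * (\<integral>\<^sup>+x. ennreal \<bar>f x\<bar> \<partial>V)"
    by (rule nn_integral_cmult) (use vm_L1D(1)[OF assms(1)] in measurable)
  also have "\<dots> \<le> ennreal c * ennreal (N1 f)"
    by (rule mult_left_mono[OF nn_integral_le_N1[OF assms(1) xs]]) simp
  finally show "(\<integral>\<^sup>+x. ennreal \<bar>h x\<bar> \<partial>V) \<le> ennreal (c * N1 f)"
    using assms(3) by (simp add: ennreal_mult')
qed (use assms(3) N1_nonneg in simp)

lemma sint_tendsto:
  assumes xs: "xs \<in> dual_ball" and A: "A \<in> sets M" and w: "integrable (Vm xs) w"
    and s: "\<And>n. s n \<in> borel_measurable M" and g: "g \<in> borel_measurable M"
    and le: "\<And>n x. x \<in> space M \<Longrightarrow> \<bar>s n x\<bar> \<le> w x"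
    and lim: "\<And>x. x \<in> space M \<Longrightarrow> (\<lambda>n. s n x) \<longlonglongrightarrow> g x"
  shows "(\<lambda>n. sint xs A (s n)) \<longlonglongrightarrow> sint xs A g"
proof -
  interpret ideal_charge M R "\<lambda>B. xs (m B)" by (rule charge[OF xs])
  have l: "(\<lambda>n. \<integral>x. indicator A x * s n x \<partial>N) \<longlonglongrightarrow> (\<integral>x. indicator A x * g x \<partial>N)"
    if N: "sets N = sets M" "integrable N w" for N
  proof (rule integral_dominated_convergence[where w = w])
    have sp: "space N = space M" by (rule sets_eq_imp_space_eq[OF N(1)])
    show "(\<lambda>x. indicator A x * g x) \<in> borel_measurable N"
      using g A by (simp add: measurable_cong_sets[OF N(1) refl])
    show "(\<lambda>x. indicator A x * s n x) \<in> borel_measurable N" for n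
      using s A by (simp add: measurable_cong_sets[OF N(1) refl])
    show "AE x in N. (\<lambda>n. indicator A x * s n x) \<longlonglongrightarrow> indicator A x * g x"
      by (rule AE_I2) (use lim sp in \<open>auto intro: tendsto_mult_left\<close>)
    show "AE x in N. norm (indicator A x * s n x) \<le> w x" for n
    proof (rule AE_I2)
      fix x assume "x \<in> space N"
      then have "\<bar>s n x\<bar> \<le> w x" using le sp by simp
      then show "norm (indicator A x * s n x) \<le> w x" by (auto simp: indicator_def)
    qed
  qed (rule N(2))
  show ?thesis
    unfolding scalar_int_def using w integrable_V_iff by (intro tendsto_diff l) auto
qed

text \<open>A bounded multiplier is a uniform limit of simple functions, and multiplication by simple
  functions preserves \<open>L1\<close>; the integrals of the approximations form a Cauchy sequence.\<close>

lemma vm_L1_solid: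
  assumes f: "f \<in> L1" and g: "g \<in> borel_measurable M"
    and le: "\<And>x. x \<in> space M \<Longrightarrow> \<bar>g x\<bar> \<le> \<bar>f x\<bar>"
  shows "g \<in> L1"
proof -
  have fm[measurable]: "f \<in> borel_measurable M" by (rule vm_L1D(1)[OF f])
  note g[measurable]
  \<comment> \<open>Where f vanishes so does g, and division by zero gives 0; hence g = k * f on the
    whole space.\<close>
  define k where "k x = g x / f x" for x
  have km[measurable]: "k \<in> borel_measurable M" unfolding k_def by measurable
  have k1: "\<bar>k x\<bar> \<le> 1" and gk: "g x = k x * f x" if "x \<in> space M" for x
    using le[OF that] by (auto simp: k_def divide_le_eq)
  \<comment> \<open>The multiplier k is rounded down to a multiple of 1 / (n + 1). Because |k| \<le>
    1, finitely many values occur.\<close>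
  define j where "j n x = \<lfloor>real (Suc n) * k x\<rfloor>" for n x
  define s where "s n x = real_of_int (j n x) / real (Suc n) * f x" for n x
  have sm[measurable]: "s n \<in> borel_measurable M" for n unfolding s_def j_def by measurable
  have gs: "\<bar>g x - s n x\<bar> \<le> 1 / real (Suc n) * \<bar>f x\<bar>" if "x \<in> space M" for n x
  proof -
    have "\<bar>real (Suc n) * k x - real_of_int (j n x)\<bar> \<le> 1" unfolding j_def by linarith
    then have "\<bar>real (Suc n) * k x - real_of_int (j n x)\<bar> / real (Suc n) \<le> 1 / real (Suc n)"
      by (rule divide_right_mono) simp
    moreover have "k x - real_of_int (j n x) / real (Suc n) = (real (Suc n) * k x - real_of_int (j n x)) / real (Suc n)"
      by (simp add: diff_divide_distrib del: of_nat_Suc)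
    ultimately have "\<bar>k x - real_of_int (j n x) / real (Suc n)\<bar> \<le> 1 / real (Suc n)"
      by (simp only: abs_divide abs_of_nat)
    then have "\<bar>k x - real_of_int (j n x) / real (Suc n)\<bar> * \<bar>f x\<bar> \<le> 1 / real (Suc n) * \<bar>f x\<bar>"
      by (rule mult_right_mono) simp
    then show ?thesis by (simp add: gk[OF that] s_def abs_mult[symmetric] left_diff_distrib)
  qed
  have sL: "s n \<in> L1" for n
  proof (rule vm_L1_cong_AE(1))
    let ?J = "{- int (Suc n)..int (Suc n)}"
    let ?B = "\<lambda>i. {x \<in> space M. j n x = i}"
    have B: "?B i \<in> sets M" for i unfolding j_def by measurable
    show "(\<lambda>x. \<Sum>i\<in>?J. real_of_int i / real (Suc n) * (indicator (?B i) x * f x)) \<in> L1"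
      by (intro vm_L1_sum vm_L1_scale vm_L1_indicator f B)
    have "(\<Sum>i\<in>?J. real_of_int i / real (Suc n) * (indicator (?B i) x * f x)) = s n x" if x: "x \<in> space M" for x
    proof -
      have "\<bar>real (Suc n) * k x\<bar> \<le> real (Suc n)"
        using mult_left_mono[OF k1[OF x], of "real (Suc n)"] by (simp add: abs_mult)
      moreover have "\<lfloor>y\<rfloor> \<in> {- int N..int N}" if "\<bar>y\<bar> \<le> real N" for y N
        using that by (auto simp: le_floor_iff floor_le_iff)
      ultimately have "j n x \<in> ?J" unfolding j_def by blast
      have "(\<Sum>i\<in>?J. real_of_int i / real (Suc n) * (indicator (?B i) x * f x))
          = (\<Sum>i\<in>?J. if i = j n x then s n x else 0)"
        by (rule sum.cong) (use x in \<open>auto simp: indicator_def s_def\<close>)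
      then show ?thesis using \<open>j n x \<in> ?J\<close> by simp
    qed
    then show "AE x in C. (\<Sum>i\<in>?J. real_of_int i / real (Suc n) * (indicator (?B i) x * f x)) = s n x"
      by (intro AE_I2) simp
  qed (rule sm)
  have nsg: "\<bar>s n x\<bar> \<le> 2 * \<bar>f x\<bar>" if "x \<in> space M" for n x
  proof -
    have "1 / real (Suc n) * \<bar>f x\<bar> \<le> 1 * \<bar>f x\<bar>" by (rule mult_right_mono) auto
    then show ?thesis using gs[OF that, of n] le[OF that] by linarith
  qed
  have s_lim: "(\<lambda>n. s n x) \<longlonglongrightarrow> g x" if "x \<in> space M" for x
  proof -
    have "(\<lambda>n. 1 / real (Suc n) * \<bar>f x\<bar>) \<longlonglongrightarrow> 0"
      using tendsto_mult_left_zero[OF lim_inverse_n', of "\<bar>f x\<bar>"] LIMSEQ_Suc by blast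
    then have "(\<lambda>n. g x - s n x) \<longlonglongrightarrow> 0"
      by (rule Lim_null_comparison[rotated]) (use gs[OF that] in simp)
    from tendsto_diff[OF tendsto_const this, of "g x"] show ?thesis by simp
  qed
  show ?thesis
  proof (rule vm_L1I[OF g])
    fix xs :: "'b \<Rightarrow> real" assume xs: "xs \<in> dual_ball"
    then interpret ideal_charge M R "\<lambda>B. xs (m B)" by (rule charge)
    show "integrable V g"
      by (rule Bochner_Integration.integrable_bound[OF vm_L1D(2)[OF f xs]]) (use le g in \<open>auto intro: AE_I2\<close>)
  next
    fix A assume A: "A \<in> sets M"
    define v where "v n = vm_int M R m (\<lambda>x. indicator A x * s n x)" for n
    have AsL: "(\<lambda>x. indicator A x * s n x) \<in> L1" for n by (rule vm_L1_indicator[OF sL A])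
    have vv: "norm (v n - v l) \<le> (1 / real (Suc n) + 1 / real (Suc l)) * N1 f" for n l
      unfolding v_def vm_int_diff[OF AsL AsL, symmetric]
    proof (rule norm_vm_int_le_scaled[OF f vm_L1_diff[OF AsL AsL]])
      fix x assume x: "x \<in> space M"
      have "\<bar>s n x - s l x\<bar> \<le> (1 / real (Suc n) + 1 / real (Suc l)) * \<bar>f x\<bar>"
        using gs[OF x, of n] gs[OF x, of l] by (simp only: distrib_right)
      then show "\<bar>indicator A x * s n x - indicator A x * s l x\<bar> \<le> (1 / real (Suc n) + 1 / real (Suc l)) * \<bar>f x\<bar>"
        by (auto simp: indicator_def)
    qed simp
    \<comment> \<open>Completeness of E enters here: the limit of v is the vector that represents
      the integral of g over A.\<close>
    have "Cauchy v"
    proof (rule CauchyI)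
      fix e :: real assume e: "0 < e"
      obtain n0 :: nat where n0: "2 * N1 f / e < real n0" using reals_Archimedean2 by blast
      show "\<exists>K. \<forall>a\<ge>K. \<forall>b\<ge>K. norm (v a - v b) < e"
      proof (intro exI[of _ n0] allI impI)
        fix a b assume ab: "n0 \<le> a" "n0 \<le> b"
        have "(1 / real (Suc a) + 1 / real (Suc b)) * N1 f \<le> (1 / real (Suc n0) + 1 / real (Suc n0)) * N1 f"
          by (intro mult_right_mono add_mono divide_left_mono N1_nonneg) (use ab in auto)
        also have "\<dots> = 2 * N1 f / real (Suc n0)" by simp
        also have "\<dots> < e"
        proof -
          have "2 * N1 f < e * real n0" using n0 e by (simp add: field_simps)
          also have "\<dots> \<le> e * real (Suc n0)" using e by simp
          finally show ?thesis by (simp add: field_simps)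
        qed
        finally show "norm (v a - v b) < e" using vv[of a b] by linarith
      qed
    qed
    then obtain u where u: "v \<longlonglongrightarrow> u" using Cauchy_convergent_iff convergent_def by blast
    have "xs u = sint xs A g" if xs: "xs \<in> dual_ball" for xs
    proof -
      have v_eq: "xs (v n) = sint xs A (s n)" for n
        using vm_int[OF AsL xs] sets.sets_into_space[OF A]
        by (simp add: v_def sint_indicator Int_absorb1)
      have "(\<lambda>n. sint xs A (s n)) \<longlonglongrightarrow> sint xs A g"
      proof (rule sint_tendsto[OF xs A, where w = "\<lambda>x. 2 * \<bar>f x\<bar>"])
        show "integrable (Vm xs) (\<lambda>x. 2 * \<bar>f x\<bar>)" using vm_L1D(2)[OF f xs] by simp
      qed (use sm g nsg s_lim in auto)
      moreover have "(\<lambda>n. xs (v n)) \<longlonglongrightarrow> xs u" by (rule dual_ball_tendsto[OF xs u])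
      ultimately show ?thesis using LIMSEQ_unique by (auto simp: v_eq)
    qed
    then show "\<exists>v. \<forall>xs\<in>dual_ball. xs v = sint xs A g" by blast
  qed
qed

lemma vm_L1_powr_diff:
  assumes q: "0 < q" and fm: "f \<in> borel_measurable M" and gm: "g \<in> borel_measurable M"
    and f: "(\<lambda>x. \<bar>f x\<bar> powr q) \<in> L1" and g: "(\<lambda>x. \<bar>g x\<bar> powr q) \<in> L1"
  shows "(\<lambda>x. \<bar>f x - g x\<bar> powr q) \<in> L1"
proof (rule vm_L1_solid)
  show "(\<lambda>x. 2 powr q * (\<bar>f x\<bar> powr q + \<bar>g x\<bar> powr q)) \<in> L1"
    by (intro vm_L1_scale vm_L1_add f g)
  show "(\<lambda>x. \<bar>f x - g x\<bar> powr q) \<in> borel_measurable M" using fm gm by measurable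
  fix x
  show "\<bar>\<bar>f x - g x\<bar> powr q\<bar> \<le> \<bar>2 powr q * (\<bar>f x\<bar> powr q + \<bar>g x\<bar> powr q)\<bar>"
    using abs_add_powr_le[OF q, of "f x" "- g x"] by simp
qed

section \<open>Integration on the intersection of Lp and L1 is factorable\<close>

lemma borel_measurable_C: "borel_measurable C = borel_measurable M"
  by (rule measurable_cong_sets) simp_all

context
  fixes p :: real
  assumes p: "0 < p"
begin

abbreviation "Y \<equiv> LpL1 M R m p"

text \<open>The exponents cancel: the p-th power of |f|^(1/p) is |f|, so the Lp condition on
  |f|^(1/p) is integrability of f itself.\<close>

lemma mem_pow_space_Y:
  "f \<in> pow_space C Y (1 / p) \<longleftrightarrow> f \<in> borel_measurable M \<and> f \<in> L1 \<and> (\<lambda>x. \<bar>f x\<bar> powr (1 / p)) \<in> L1"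
  using p by (auto simp: pow_space_def borel_measurable_C LpL1_def vm_Lp_def powr_powr vm_L1_abs_iff
      dest: vm_L1D(1))

lemma mem_Y: "f \<in> Y \<longleftrightarrow> f \<in> L1 \<and> (\<lambda>x. \<bar>f x\<bar> powr p) \<in> L1"
  by (auto simp: LpL1_def vm_Lp_def dest: vm_L1D(1))

lemma sum_space_YE:
  assumes "h \<in> sum_space C Y p"
  obtains f1 f2 where "f1 \<in> pow_space C Y (1 / p)" "f2 \<in> Y" "AE x in C. h x = f1 x + f2 x"
  using assms by (auto simp: sum_space_def)

lemma vm_L1_sum_space:
  assumes h: "h \<in> borel_measurable M" and f: "f1 \<in> pow_space C Y (1 / p)" "f2 \<in> Y"
    and ae: "AE x in C. h x = f1 x + f2 x"
  shows "h \<in> L1" "vm_int M R m h = vm_int M R m f1 + vm_int M R m f2"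
proof -
  have L: "f1 \<in> L1" "f2 \<in> L1" using f by (auto simp: mem_pow_space_Y mem_Y)
  have ae': "AE x in C. f1 x + f2 x = h x" using ae by eventually_elim simp
  show "h \<in> L1" by (rule vm_L1_cong_AE(1)[OF vm_L1_add[OF L] h ae'])
  show "vm_int M R m h = vm_int M R m f1 + vm_int M R m f2"
    by (simp add: vm_int_cong_AE[OF vm_L1_add[OF L] h ae'] vm_int_add[OF L])
qed

lemma sum_space_Y_subset: "sum_space C Y p \<subseteq> L1"
  by (auto simp: sum_space_def borel_measurable_C intro: vm_L1_sum_space(1))

text \<open>Continuity is expressed through differences s n - f, which must belong to the sum space
  before its norm estimate applies.\<close>

lemma sum_space_Y_diff:
  assumes h: "h \<in> sum_space C Y p" and k: "k \<in> sum_space C Y p"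
  shows "(\<lambda>x. h x - k x) \<in> sum_space C Y p"
proof -
  obtain f1 f2 where f: "f1 \<in> pow_space C Y (1 / p)" "f2 \<in> Y" "AE x in C. h x = f1 x + f2 x"
    using h by (rule sum_space_YE)
  obtain g1 g2 where g: "g1 \<in> pow_space C Y (1 / p)" "g2 \<in> Y" "AE x in C. k x = g1 x + g2 x"
    using k by (rule sum_space_YE)
  have hk: "h \<in> borel_measurable M" "k \<in> borel_measurable M"
    using h k by (auto simp: sum_space_def borel_measurable_C)
  have 1: "(\<lambda>x. f1 x - g1 x) \<in> pow_space C Y (1 / p)"
    using f(1) g(1) p unfolding mem_pow_space_Y by (auto intro!: vm_L1_diff vm_L1_powr_diff)
  have 2: "(\<lambda>x. f2 x - g2 x) \<in> Y"
    using f(2) g(2) p unfolding mem_Y by (auto intro!: vm_L1_diff vm_L1_powr_diff dest: vm_L1D(1))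
  have 3: "AE x in C. h x - k x = (f1 x - g1 x) + (f2 x - g2 x)"
    using f(3) g(3) by eventually_elim simp
  show ?thesis
    unfolding sum_space_def borel_measurable_C
    by (intro CollectI conjI exI[of _ "\<lambda>x. f1 x - g1 x"] exI[of _ "\<lambda>x. f2 x - g2 x"] 1 2 3)
      (use hk in measurable)
qed

text \<open>The Lp-norm of |f|^(1/p) is the p-th root of the L1-norm of f, and
  \<open>pow_norm\<close> with exponent 1 / p raises it back to the power p. This is why the
  estimate has constant 1.\<close>

lemma N1_le_pow_norm:
  "N1 f \<le> pow_norm (LpL1_norm M R m p) (1 / p) f"
proof -
  have "N1 f = (N1 f powr (1 / p)) powr p" using p by (simp add: powr_powr N1_nonneg)
  also have "\<dots> = vm_Lp_norm M R m p (\<lambda>x. \<bar>f x\<bar> powr (1 / p)) powr p"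
    using p by (simp add: vm_Lp_norm_def powr_powr N1_abs)
  also have "\<dots> \<le> LpL1_norm M R m p (\<lambda>x. \<bar>f x\<bar> powr (1 / p)) powr p"
    by (rule powr_mono2) (use p in \<open>auto simp: LpL1_norm_def vm_Lp_norm_def\<close>)
  finally show ?thesis by (simp add: pow_norm_def)
qed

text \<open>The integral of h does not depend on how h is split, so the bound valid for each
  splitting passes to the infimum.\<close>

lemma norm_vm_int_le_sum_norm:
  assumes h: "h \<in> sum_space C Y p"
  shows "norm (vm_int M R m h) \<le> sum_norm C Y (LpL1_norm M R m p) p h"
  unfolding sum_norm_def
proof (rule cInf_greatest)
  show "{pow_norm (LpL1_norm M R m p) (1 / p) f1 + LpL1_norm M R m p f2 |f1 f2.
      f1 \<in> pow_space C Y (1 / p) \<and> f2 \<in> Y \<and> (AE x in C. h x = f1 x + f2 x)} \<noteq> {}"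
    using h by (auto elim!: sum_space_YE)
  fix r assume "r \<in> {pow_norm (LpL1_norm M R m p) (1 / p) f1 + LpL1_norm M R m p f2 |f1 f2.
      f1 \<in> pow_space C Y (1 / p) \<and> f2 \<in> Y \<and> (AE x in C. h x = f1 x + f2 x)}"
  then obtain f1 f2 where r: "r = pow_norm (LpL1_norm M R m p) (1 / p) f1 + LpL1_norm M R m p f2"
    and f: "f1 \<in> pow_space C Y (1 / p)" "f2 \<in> Y" "AE x in C. h x = f1 x + f2 x" by blast
  have L: "f1 \<in> L1" "f2 \<in> L1" using f by (auto simp: mem_pow_space_Y mem_Y)
  have hm: "h \<in> borel_measurable M" using h by (auto simp: sum_space_def borel_measurable_C)
  have "norm (vm_int M R m h) \<le> norm (vm_int M R m f1) + norm (vm_int M R m f2)"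
    using vm_L1_sum_space(2)[OF hm f] norm_triangle_ineq by simp
  also have "\<dots> \<le> N1 f1 + N1 f2" by (intro add_mono norm_vm_int_le L)
  also have "\<dots> \<le> r"
    unfolding r by (rule add_mono[OF N1_le_pow_norm]) (simp add: LpL1_norm_def)
  finally show "norm (vm_int M R m h) \<le> r" .
qed

theorem vm_int_factorable:
  "pth_power_factorable C Y (LpL1_norm M R m p) p (vm_int M R m)"
  unfolding pth_power_factorable_def
proof (intro exI conjI)
  show "linear_on (sum_space C Y p) (vm_int M R m)"
    using sum_space_Y_subset by (auto simp: linear_on_def vm_int_add vm_int_scale subset_iff)
  show "respects_ae C (sum_space C Y p) (vm_int M R m)"
    unfolding respects_ae_def
  proof (intro ballI impI)
    fix f g assume fg: "f \<in> sum_space C Y p" "g \<in> sum_space C Y p" "AE x in C. f x = g x"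
    then have "f \<in> L1" "g \<in> borel_measurable M" using sum_space_Y_subset vm_L1D(1) by auto
    then show "vm_int M R m f = vm_int M R m g" using vm_int_cong_AE[of f g] fg(3) by simp
  qed
  show "qcontinuous (sum_space C Y p) (sum_norm C Y (LpL1_norm M R m p) p) (vm_int M R m)"
    unfolding qcontinuous_def
  proof (intro allI impI)
    fix s f
    assume s: "\<forall>n. s n \<in> sum_space C Y p" and f: "f \<in> sum_space C Y p"
      and lim: "(\<lambda>n. sum_norm C Y (LpL1_norm M R m p) p (\<lambda>x. s n x - f x)) \<longlonglongrightarrow> 0"
    have "norm (vm_int M R m (s n) - vm_int M R m f) \<le> sum_norm C Y (LpL1_norm M R m p) p (\<lambda>x. s n x - f x)" for n
      using norm_vm_int_le_sum_norm[OF sum_space_Y_diff[OF s[rule_format, of n] f]] sum_space_Y_subset s f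
      by (simp add: vm_int_diff subset_iff)
    then have "(\<lambda>n. vm_int M R m (s n) - vm_int M R m f) \<longlonglongrightarrow> 0"
      by (intro Lim_null_comparison[OF _ lim]) simp
    then show "(\<lambda>n. vm_int M R m (s n)) \<longlonglongrightarrow> vm_int M R m f" by (rule LIM_zero_cancel)
  qed
qed simp

end

end

subsection \<open>Order continuous operators are integrals\<close>

text \<open>Collects the order properties shared by X, Z and their powers 1 / p, free of any
  quasi-norm. R and m can thus remain those of X while D and U change.\<close>

locale order_continuous_operator = set_ideal +
  fixes m :: "'a set \<Rightarrow> 'b::banach" and D :: "('a \<Rightarrow> real) set" and U :: "('a \<Rightarrow> real) \<Rightarrow> 'b"
  assumes cover: "\<exists>\<Omega>::nat \<Rightarrow> 'a set. (\<forall>n. \<Omega> n \<in> R) \<and> (\<Union>n. \<Omega> n) = space M"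
    and D_meas: "D \<subseteq> borel_measurable M"
    and D_add: "f \<in> D \<Longrightarrow> g \<in> D \<Longrightarrow> (\<lambda>x. f x + g x) \<in> D"
    and D_scale: "f \<in> D \<Longrightarrow> (\<lambda>x. c * f x) \<in> D"
    and D_solid: "f \<in> D \<Longrightarrow> g \<in> borel_measurable M \<Longrightarrow> (\<And>x. x \<in> space M \<Longrightarrow> \<bar>g x\<bar> \<le> \<bar>f x\<bar>) \<Longrightarrow> g \<in> D"
    and D_ind: "A \<in> R \<Longrightarrow> indicator A \<in> D"
    and U_lin: "linear_on D U"
    and U_ind: "A \<in> R \<Longrightarrow> U (indicator A) = m A"
    and order_bounded: "f \<in> D \<Longrightarrow> \<exists>c. \<forall>h\<in>D. (\<forall>x\<in>space M. \<bar>h x\<bar> \<le> \<bar>f x\<bar>) \<longrightarrow> norm (U h) \<le> c"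
    and order_continuous: "(\<And>n. s n \<in> D) \<Longrightarrow> (\<And>n x. x \<in> space M \<Longrightarrow> s (Suc n) x \<le> s n x) \<Longrightarrow>
      (\<And>x. x \<in> space M \<Longrightarrow> (\<lambda>n. s n x) \<longlonglongrightarrow> 0) \<Longrightarrow> (\<lambda>n. U (s n)) \<longlonglongrightarrow> 0"
begin

lemma ideal_charge_dual:
  assumes xs: "xs \<in> dual_ball"
  shows "ideal_charge M R (\<lambda>B. xs (m B))"
proof
  fix A B assume AB: "A \<in> R" "B \<in> R" "A \<inter> B = {}"
  have "U (\<lambda>x. indicator A x + indicator B x) = U (indicator A) + U (indicator B)"
    using U_lin D_ind AB by (simp add: linear_on_def)
  moreover have "(\<lambda>x. indicator A x + indicator B x :: real) = indicator (A \<union> B)"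
    using AB(3) by (auto simp: indicator_def fun_eq_iff)
  ultimately have "m (A \<union> B) = m A + m B" using AB R_Un[OF AB(1,2)] by (simp add: U_ind)
  then show "xs (m (A \<union> B)) = xs (m A) + xs (m B)" by (simp add: linear_add[OF dual_ball_linear[OF xs]])
next
  fix S :: "nat \<Rightarrow> 'a set" assume S: "\<And>n. S n \<in> R" "decseq S" "(\<Inter>n. S n) = {}"
  have "(\<lambda>n. U (indicator (S n))) \<longlonglongrightarrow> 0"
  proof (rule order_continuous)
    show "indicator (S n) \<in> D" for n by (rule D_ind[OF S(1)])
    show "indicator (S (Suc n)) x \<le> (indicator (S n) x :: real)" for n x
      using S(2) by (auto simp: indicator_def decseq_Suc_iff)
    have "(\<lambda>n. indicator (S n) x :: real) \<longlonglongrightarrow> indicator (\<Inter>n. S n) x" for x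
      by (rule LIMSEQ_indicator_decseq[OF S(2)])
    then show "(\<lambda>n. indicator (S n) x :: real) \<longlonglongrightarrow> 0" for x
      unfolding S(3) by simp
  qed
  then have "(\<lambda>n. m (S n)) \<longlonglongrightarrow> 0" by (simp add: U_ind[OF S(1)])
  then show "(\<lambda>n. xs (m (S n))) \<longlonglongrightarrow> 0"
    using dual_ball_tendsto[OF xs] linear_0[OF dual_ball_linear[OF xs]] by fastforce
next
  fix A assume A: "A \<in> R"
  obtain c where c: "\<And>h. h \<in> D \<Longrightarrow> (\<And>x. x \<in> space M \<Longrightarrow> \<bar>h x\<bar> \<le> \<bar>indicator A x\<bar>) \<Longrightarrow> norm (U h) \<le> c"
    using order_bounded[OF D_ind[OF A]] by metis
  have "\<bar>xs (m B)\<bar> \<le> c" if "B \<in> R" "B \<subseteq> A" for B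
  proof -
    have "norm (U (indicator B)) \<le> c"
      by (rule c[OF D_ind[OF that(1)]]) (use that(2) in \<open>auto simp: indicator_def\<close>)
    then show ?thesis using dual_ball_le_norm[OF xs, of "m B"] by (simp add: U_ind[OF that(1)])
  qed
  then show "\<exists>c. \<forall>B\<in>R. B \<subseteq> A \<longrightarrow> \<bar>xs (m B)\<bar> \<le> c" by blast
qed

sublocale vector_charge M R m
  by (rule vector_charge.intro) (rule ideal_charge_dual)

lemma order_continuous_functional_dual:
  assumes xs: "xs \<in> dual_ball"
  shows "order_continuous_functional M R (\<lambda>B. xs (m B)) D (\<lambda>f. xs (U f))"
proof -
  interpret ideal_charge M R "\<lambda>B. xs (m B)" by (rule ideal_charge_dual[OF xs])
  show ?thesis
  proof
    show "linear_on D (\<lambda>f. xs (U f))"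
      using U_lin by (simp add: linear_on_def linear_add[OF dual_ball_linear[OF xs]] linear_scale[OF dual_ball_linear[OF xs]])
  next
    fix f assume "f \<in> D"
    then obtain c where "\<forall>h\<in>D. (\<forall>x\<in>space M. \<bar>h x\<bar> \<le> \<bar>f x\<bar>) \<longrightarrow> norm (U h) \<le> c"
      using order_bounded by meson
    then show "\<exists>c. \<forall>h\<in>D. (\<forall>x\<in>space M. \<bar>h x\<bar> \<le> \<bar>f x\<bar>) \<longrightarrow> xs (U h) \<le> c"
      using dual_ball_le_norm[OF xs] by (meson abs_ge_self order_trans)
  next
    fix s :: "nat \<Rightarrow> 'a \<Rightarrow> real"
    assume "\<And>n. s n \<in> D" "\<And>n x. x \<in> space M \<Longrightarrow> s (Suc n) x \<le> s n x"
      "\<And>x. x \<in> space M \<Longrightarrow> (\<lambda>n. s n x) \<longlonglongrightarrow> 0"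
    then have "(\<lambda>n. U (s n)) \<longlonglongrightarrow> 0" by (rule order_continuous)
    then show "(\<lambda>n. xs (U (s n))) \<longlonglongrightarrow> 0"
      using dual_ball_tendsto[OF xs] linear_0[OF dual_ball_linear[OF xs]] by fastforce
  qed (fact D_meas cover D_add D_scale D_ind | simp add: U_ind; fail | erule (1) D_solid; assumption)+
qed

lemma D_subset_L1: "D \<subseteq> vm_L1 M R m"
proof
  fix f assume f: "f \<in> D"
  show "f \<in> vm_L1 M R m"
  proof (rule vm_L1I)
    show "f \<in> borel_measurable M" using f D_meas by blast
    fix xs :: "'b \<Rightarrow> real" assume "xs \<in> dual_ball"
    then interpret order_continuous_functional M R "\<lambda>B. xs (m B)" D "\<lambda>f. xs (U f)"
      by (rule order_continuous_functional_dual)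
    show "integrable V f" by (rule integrable_V[OF f])
  next
    fix A assume "A \<in> sets M"
    then show "\<exists>v. \<forall>xs\<in>dual_ball. xs v = scalar_int M R (\<lambda>B. xs (m B)) A f"
      using order_continuous_functional.scalar_int_eq[OF order_continuous_functional_dual f]
      by (intro exI[of _ "U (\<lambda>x. indicator A x * f x)"]) simp
  qed
qed

lemma vm_int_eq:
  assumes f: "f \<in> D"
  shows "vm_int M R m f = U f"
proof (rule vm_int_eqI)
  fix xs :: "'b \<Rightarrow> real" assume xs: "xs \<in> dual_ball"
  then interpret order_continuous_functional M R "\<lambda>B. xs (m B)" D "\<lambda>f. xs (U f)"
    by (rule order_continuous_functional_dual)
  have "scalar_int M R (\<lambda>B. xs (m B)) (space M) f = \<psi> f"
    unfolding scalar_int_def \<psi>_def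
    by (intro arg_cong2[where f = minus] Bochner_Integration.integral_cong) auto
  then show "xs (U f) = scalar_int M R (\<lambda>B. xs (m B)) (space M) f"
    using \<phi>_eq_\<psi>[OF f] by simp
qed

text \<open>Here f need not lie in D. The vectors U h with h in D and |h| \<le> |f| are weakly
  bounded by the integrals of |f|, hence bounded in norm by a c independent of the functional;
  \<open>nn_integral_V_le\<close> then turns c into a uniform bound on those integrals.\<close>

sublocale bounded_vector_charge M R m
proof
  fix f assume f: "f \<in> vm_L1 M R m"
  let ?H = "{h \<in> D. \<forall>x\<in>space M. \<bar>h x\<bar> \<le> \<bar>f x\<bar>}"
  have "\<exists>c. \<forall>w\<in>U ` ?H. norm w \<le> c"
  proof (rule weakly_bounded_imp_bounded)
    fix xs :: "'b \<Rightarrow> real" assume xs: "xs \<in> dual_ball"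
    then interpret order_continuous_functional M R "\<lambda>B. xs (m B)" D "\<lambda>f. xs (U f)"
      by (rule order_continuous_functional_dual)
    have fi: "integrable P f" "integrable Q f" using vm_L1D(2)[OF f xs] integrable_V_iff by auto
    have "xs (U h) \<le> (\<integral>x. \<bar>f x\<bar> \<partial>P) + (\<integral>x. \<bar>f x\<bar> \<partial>Q)" if h: "h \<in> ?H" for h
    proof -
      have hD: "h \<in> D" using h by simp
      have "(\<integral>x. \<bar>h x\<bar> \<partial>N) \<le> (\<integral>x. \<bar>f x\<bar> \<partial>N)" if "integrable N f" "integrable N h" "space N = space M" for N
        by (rule integral_mono) (use that h in auto)
      then have "(\<integral>x. \<bar>h x\<bar> \<partial>P) \<le> (\<integral>x. \<bar>f x\<bar> \<partial>P)" "(\<integral>x. \<bar>h x\<bar> \<partial>Q) \<le> (\<integral>x. \<bar>f x\<bar> \<partial>Q)"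
        using fi integrable_PQ[OF hD] by simp_all
      then show ?thesis
        using \<phi>_eq_\<psi>[OF hD] integral_abs_bound[of P h] integral_abs_bound[of Q h]
        unfolding \<psi>_def by linarith
    qed
    then show "\<exists>c. \<forall>w\<in>U ` ?H. xs w \<le> c" by blast
  qed
  then obtain c where c: "\<And>h. h \<in> ?H \<Longrightarrow> norm (U h) \<le> c" by blast
  have "(\<lambda>x. 0) \<in> ?H" using D_scale[OF D_ind[OF R_empty], of 0] by simp
  from c[OF this] have c0: "0 \<le> c" using norm_ge_zero order_trans by blast
  have "(\<integral>\<^sup>+x. ennreal \<bar>f x\<bar> \<partial>var_measure M R (\<lambda>B. xs (m B))) \<le> ennreal (2 * c)" if xs: "xs \<in> dual_ball" for xs
  proof -
    interpret order_continuous_functional M R "\<lambda>B. xs (m B)" D "\<lambda>f. xs (U f)"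
      by (rule order_continuous_functional_dual[OF xs])
    show ?thesis
    proof (rule nn_integral_V_le[OF vm_L1D(1)[OF f] c0])
      fix h assume "h \<in> D" "\<And>x. x \<in> space M \<Longrightarrow> \<bar>h x\<bar> \<le> \<bar>f x\<bar>"
      then have "norm (U h) \<le> c" by (intro c) simp
      then show "xs (U h) \<le> c" using dual_ball_le_norm[OF xs, of "U h"] by linarith
    qed
  qed
  then show "\<exists>c. \<forall>xs\<in>dual_ball. (\<integral>\<^sup>+x. ennreal \<bar>f x\<bar> \<partial>var_measure M R (\<lambda>B. xs (m B))) \<le> ennreal c"
    by blast
qed

end

subsection \<open>Quasi-Banach function spaces and power factorability\<close>

lemma qBfsD:
  assumes "qBfs L Y N"
  shows "Y \<subseteq> borel_measurable L"
    and "(\<lambda>x. 0) \<in> Y"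
    and "f \<in> Y \<Longrightarrow> g \<in> Y \<Longrightarrow> (\<lambda>x. f x + g x) \<in> Y"
    and "f \<in> Y \<Longrightarrow> (\<lambda>x. c * f x) \<in> Y"
    and "f \<in> Y \<Longrightarrow> g \<in> borel_measurable L \<Longrightarrow> AE x in L. \<bar>g x\<bar> \<le> \<bar>f x\<bar> \<Longrightarrow> g \<in> Y"
    and "f \<in> Y \<Longrightarrow> N (\<lambda>x. c * f x) = \<bar>c\<bar> * N f"
    and "f \<in> Y \<Longrightarrow> g \<in> Y \<Longrightarrow> AE x in L. \<bar>f x\<bar> \<le> \<bar>g x\<bar> \<Longrightarrow> N f \<le> N g"
  using assms unfolding qBfs_def by blast+

lemma qBfs_zero:
  assumes "qBfs L Y N"
  shows "N (\<lambda>x. 0) = 0"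
  using qBfsD(6)[OF assms qBfsD(2)[OF assms], where c = 0] by simp

lemma qBfs_nonneg:
  assumes "qBfs L Y N" "f \<in> Y"
  shows "0 \<le> N f"
  using qBfsD(7)[OF assms(1) qBfsD(2)[OF assms(1)] assms(2)] qBfs_zero[OF assms(1)] by simp

text \<open>Reading a space as its own first power lets one argument with exponent q serve both
  summands, q = 1 and q = 1 / p.\<close>

lemma pow_space_1: "qBfs L Y N \<Longrightarrow> pow_space L Y 1 = Y"
proof (intro set_eqI iffI)
  fix f assume Y: "qBfs L Y N"
  {
    assume "f \<in> pow_space L Y 1"
    then have "f \<in> borel_measurable L" "(\<lambda>x. \<bar>f x\<bar>) \<in> Y" by (auto simp: pow_space_def)
    then show "f \<in> Y" using qBfsD(5)[OF Y, where f = "\<lambda>x. \<bar>f x\<bar>" and g = f] by simp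
  next
    assume "f \<in> Y"
    moreover from this have "f \<in> borel_measurable L" using qBfsD(1)[OF Y] by blast
    moreover from calculation have "(\<lambda>x. \<bar>f x\<bar>) \<in> Y"
      using qBfsD(5)[OF Y, where f = f and g = "\<lambda>x. \<bar>f x\<bar>"] by simp
    ultimately show "f \<in> pow_space L Y 1" by (simp add: pow_space_def)
  }
qed

lemma pow_norm_1:
  assumes Y: "qBfs L Y N" and f: "f \<in> Y"
  shows "pow_norm N 1 f = N f"
proof -
  have "(\<lambda>x. \<bar>f x\<bar>) \<in> Y" using pow_space_1[OF Y] f by (auto simp: pow_space_def)
  then have "N (\<lambda>x. \<bar>f x\<bar>) = N f" using f by (intro antisym qBfsD(7)[OF Y]) auto
  then show ?thesis using qBfs_nonneg[OF Y f] by (simp add: pow_norm_def)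
qed

lemma sum_norm_bounds:
  assumes Y: "qBfs L Y N"
    and f: "f1 \<in> pow_space L Y (1 / p)" "f2 \<in> Y" "AE x in L. f x = f1 x + f2 x"
  shows "0 \<le> sum_norm L Y N p f" "sum_norm L Y N p f \<le> pow_norm N (1 / p) f1 + N f2"
proof -
  let ?S = "{pow_norm N (1 / p) f1 + N f2 |f1 f2.
      f1 \<in> pow_space L Y (1 / p) \<and> f2 \<in> Y \<and> (AE x in L. f x = f1 x + f2 x)}"
  have mem: "pow_norm N (1 / p) f1 + N f2 \<in> ?S" using f by blast
  have nonneg: "0 \<le> r" if "r \<in> ?S" for r
    using that qBfs_nonneg[OF Y] by (auto simp: pow_norm_def)
  show "0 \<le> sum_norm L Y N p f"
    unfolding sum_norm_def by (rule cInf_greatest) (use mem nonneg in auto)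
  show "sum_norm L Y N p f \<le> pow_norm N (1 / p) f1 + N f2"
    unfolding sum_norm_def by (rule cInf_lower[OF mem bdd_belowI[of _ 0]]) (rule nonneg)
qed

lemma pow_space_zero:
  assumes "qBfs L Y N"
  shows "(\<lambda>x. 0) \<in> pow_space L Y q" "pow_norm N q (\<lambda>x. 0) = 0"
  using qBfsD(2)[OF assms] qBfs_zero[OF assms] by (simp_all add: pow_space_def pow_norm_def)

lemma pow_space_subset_sum_space:
  assumes Y: "qBfs L Y N" and q: "q = 1 \<or> q = 1 / p" and f: "f \<in> pow_space L Y q"
  shows "f \<in> sum_space L Y p" "0 \<le> sum_norm L Y N p f" "sum_norm L Y N p f \<le> pow_norm N q f"
proof -
  have fm: "f \<in> borel_measurable L" using f by (simp add: pow_space_def)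
  have "\<exists>f1 f2. f1 \<in> pow_space L Y (1 / p) \<and> f2 \<in> Y \<and> (AE x in L. f x = f1 x + f2 x) \<and>
      pow_norm N (1 / p) f1 + N f2 = pow_norm N q f"
  proof (cases "q = 1")
    case True
    then have "f \<in> Y" using f pow_space_1[OF Y] by simp
    then show ?thesis
      using True pow_space_zero[OF Y, of "1 / p"] pow_norm_1[OF Y]
      by (intro exI[of _ "\<lambda>x. 0"] exI[of _ f]) simp
  next
    case False
    then have "q = 1 / p" using q by simp
    then show ?thesis using f qBfsD(2)[OF Y] qBfs_zero[OF Y]
      by (intro exI[of _ f] exI[of _ "\<lambda>x. 0"]) simp
  qed
  then obtain f1 f2 where d: "f1 \<in> pow_space L Y (1 / p)" "f2 \<in> Y" "AE x in L. f x = f1 x + f2 x"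
    "pow_norm N (1 / p) f1 + N f2 = pow_norm N q f" by blast
  show "f \<in> sum_space L Y p" unfolding sum_space_def using fm d by blast
  show "0 \<le> sum_norm L Y N p f" "sum_norm L Y N p f \<le> pow_norm N q f"
    using sum_norm_bounds[OF Y d(1-3)] d(4) by simp_all
qed

lemma linear_on_zero:
  assumes "linear_on D U" "(\<lambda>x. 0) \<in> D"
  shows "U (\<lambda>x. 0) = 0"
  using assms(1)[unfolded linear_on_def, THEN conjunct2, rule_format, OF assms(2), of 0] by simp

lemma factorable_continuous:
  assumes Y: "qBfs L Y N" and q: "q = 1 \<or> q = 1 / p"
    and lin: "linear_on (sum_space L Y p) U"
    and cont: "qcontinuous (sum_space L Y p) (sum_norm L Y N p) U"
    and s: "\<And>n. s n \<in> pow_space L Y q" and lim: "(\<lambda>n. pow_norm N q (s n)) \<longlonglongrightarrow> 0"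
  shows "(\<lambda>n. U (s n)) \<longlonglongrightarrow> 0"
proof -
  note P = pow_space_subset_sum_space[OF Y q]
  have z: "(\<lambda>x. 0) \<in> sum_space L Y p" by (rule P(1)[OF pow_space_zero(1)[OF Y]])
  have U0: "U (\<lambda>x. 0) = 0" by (rule linear_on_zero[OF lin z])
  have "(\<lambda>n. sum_norm L Y N p (s n)) \<longlonglongrightarrow> 0"
    by (rule tendsto_sandwich[OF _ _ tendsto_const lim]) (use P(2,3)[OF s] in auto)
  then have "(\<lambda>n. sum_norm L Y N p (\<lambda>x. s n x - 0)) \<longlonglongrightarrow> 0" by simp
  then have "(\<lambda>n. U (s n)) \<longlonglongrightarrow> U (\<lambda>x. 0)"
    using cont P(1)[OF s] z unfolding qcontinuous_def by blast
  then show ?thesis by (simp add: U0)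
qed

lemma pow_space_solid:
  assumes Y: "qBfs L Y N" and q: "0 < q" and f: "f \<in> pow_space L Y q"
    and g: "g \<in> borel_measurable L" and le: "\<And>x. x \<in> space L \<Longrightarrow> \<bar>g x\<bar> \<le> \<bar>f x\<bar>"
  shows "g \<in> pow_space L Y q" "N (\<lambda>x. \<bar>g x\<bar> powr q) \<le> N (\<lambda>x. \<bar>f x\<bar> powr q)"
proof -
  have fY: "(\<lambda>x. \<bar>f x\<bar> powr q) \<in> Y" using f by (simp add: pow_space_def)
  have ae: "AE x in L. \<bar>\<bar>g x\<bar> powr q\<bar> \<le> \<bar>\<bar>f x\<bar> powr q\<bar>"
    by (rule AE_I2) (use le q in \<open>auto intro: powr_mono2\<close>)
  have gY: "(\<lambda>x. \<bar>g x\<bar> powr q) \<in> Y"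
    by (rule qBfsD(5)[OF Y fY _ ae]) (use g in measurable)
  show "g \<in> pow_space L Y q" using g gY by (simp add: pow_space_def)
  show "N (\<lambda>x. \<bar>g x\<bar> powr q) \<le> N (\<lambda>x. \<bar>f x\<bar> powr q)" by (rule qBfsD(7)[OF Y gY fY ae])
qed

lemma pow_space_scale:
  assumes Y: "qBfs L Y N" and q: "0 < q" and f: "f \<in> pow_space L Y q"
  shows "(\<lambda>x. c * f x) \<in> pow_space L Y q" "pow_norm N q (\<lambda>x. c * f x) = \<bar>c\<bar> * pow_norm N q f"
proof -
  have fY: "(\<lambda>x. \<bar>f x\<bar> powr q) \<in> Y" and fm: "f \<in> borel_measurable L"
    using f by (auto simp: pow_space_def)
  have e: "\<bar>c * f x\<bar> powr q = \<bar>c\<bar> powr q * \<bar>f x\<bar> powr q" for x by (simp add: abs_mult powr_mult)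
  show "(\<lambda>x. c * f x) \<in> pow_space L Y q"
    using qBfsD(4)[OF Y fY] fm by (simp add: pow_space_def e)
  show "pow_norm N q (\<lambda>x. c * f x) = \<bar>c\<bar> * pow_norm N q f"
    using q qBfs_nonneg[OF Y fY]
    by (simp add: pow_norm_def e qBfsD(6)[OF Y fY] powr_mult powr_powr)
qed

lemma pow_space_add:
  assumes Y: "qBfs L Y N" and q: "0 < q" and f: "f \<in> pow_space L Y q" and g: "g \<in> pow_space L Y q"
  shows "(\<lambda>x. f x + g x) \<in> pow_space L Y q"
proof -
  have Yfg: "(\<lambda>x. \<bar>f x\<bar> powr q) \<in> Y" "(\<lambda>x. \<bar>g x\<bar> powr q) \<in> Y"
    and m: "f \<in> borel_measurable L" "g \<in> borel_measurable L"
    using f g by (auto simp: pow_space_def)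
  have "(\<lambda>x. \<bar>f x + g x\<bar> powr q) \<in> Y"
  proof (rule qBfsD(5)[OF Y qBfsD(4)[OF Y qBfsD(3)[OF Y Yfg]]])
    show "AE x in L. \<bar>\<bar>f x + g x\<bar> powr q\<bar> \<le> \<bar>2 powr q * (\<bar>f x\<bar> powr q + \<bar>g x\<bar> powr q)\<bar>"
      using abs_add_powr_le[OF q] by (intro AE_I2) simp
  qed (use m in measurable)
  then show ?thesis using m by (simp add: pow_space_def)
qed

context set_ideal
begin

text \<open>Sequential continuity of U at 0 yields both order properties: boundedness on order
  intervals by rescaling a supposed unbounded sequence, and order continuity because t \<mapsto> t^q
  carries decreasing null sequences of the power space to such sequences in Y.\<close>

lemma order_continuous_operator_pow_space:
  fixes U :: "('a \<Rightarrow> real) \<Rightarrow> 'b::banach"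
  assumes cover: "\<exists>\<Omega>::nat \<Rightarrow> 'a set. (\<forall>n. \<Omega> n \<in> R) \<and> (\<Union>n. \<Omega> n) = space M"
    and L: "sets L = sets M" and Y: "qBfs L Y N" and soc: "sigma_order_continuous L Y N" and q: "0 < q"
    and R_ind: "\<And>A. A \<in> R \<Longrightarrow> indicator A \<in> Y"
    and lin: "linear_on (pow_space L Y q) U" and U_ind: "\<And>A. A \<in> R \<Longrightarrow> U (indicator A) = m A"
    and cont: "\<And>s. (\<And>n. s n \<in> pow_space L Y q) \<Longrightarrow> (\<lambda>n. pow_norm N q (s n)) \<longlonglongrightarrow> 0 \<Longrightarrow>
      (\<lambda>n. U (s n)) \<longlonglongrightarrow> 0"
  shows "order_continuous_operator M R m (pow_space L Y q) U"
proof
  let ?D = "pow_space L Y q"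
  have sp: "space L = space M" by (rule sets_eq_imp_space_eq[OF L])
  have bm: "borel_measurable L = borel_measurable M" by (rule measurable_cong_sets[OF L refl])
  show "\<exists>\<Omega>::nat \<Rightarrow> 'a set. (\<forall>n. \<Omega> n \<in> R) \<and> (\<Union>n. \<Omega> n) = space M" by (rule cover)
  show "?D \<subseteq> borel_measurable M" by (auto simp: pow_space_def bm)
  show "(\<lambda>x. f x + g x) \<in> ?D" if "f \<in> ?D" "g \<in> ?D" for f g by (rule pow_space_add[OF Y q that])
  show "(\<lambda>x. c * f x) \<in> ?D" if "f \<in> ?D" for f c by (rule pow_space_scale(1)[OF Y q that])
  show "g \<in> ?D" if "f \<in> ?D" "g \<in> borel_measurable M" "\<And>x. x \<in> space M \<Longrightarrow> \<bar>g x\<bar> \<le> \<bar>f x\<bar>" for f g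
    by (rule pow_space_solid(1)[OF Y q that(1)]) (use that(2,3) in \<open>simp_all add: bm sp\<close>)
  show "indicator A \<in> ?D" if "A \<in> R" for A
  proof -
    have "\<bar>indicator A x\<bar> powr q = (indicator A x :: real)" for x by (simp add: indicator_def)
    then show ?thesis using R_ind[OF that] qBfsD(1)[OF Y] by (auto simp: pow_space_def)
  qed
  show "linear_on ?D U" by (rule lin)
  show "U (indicator A) = m A" if "A \<in> R" for A by (rule U_ind[OF that])
  show "\<exists>c. \<forall>h\<in>?D. (\<forall>x\<in>space M. \<bar>h x\<bar> \<le> \<bar>f x\<bar>) \<longrightarrow> norm (U h) \<le> c" if f: "f \<in> ?D" for f
  proof (rule ccontr)
    assume "\<not> ?thesis"
    then have "\<forall>n::nat. \<exists>h\<in>?D. (\<forall>x\<in>space M. \<bar>h x\<bar> \<le> \<bar>f x\<bar>) \<and> real (Suc n) < norm (U h)"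
      by (metis not_le)
    then obtain h where h: "\<And>n. h n \<in> ?D" "\<And>n x. x \<in> space M \<Longrightarrow> \<bar>h n x\<bar> \<le> \<bar>f x\<bar>"
      "\<And>n. real (Suc n) < norm (U (h n))" by metis
    \<comment> \<open>The factor 1 / (n + 1) sends the order bounded functions h n to 0 in
      quasi-norm, while their images keep norm at least 1 by the choice of h n.\<close>
    let ?s = "\<lambda>n x. 1 / real (Suc n) * h n x"
    have sD: "?s n \<in> ?D" for n by (rule pow_space_scale(1)[OF Y q h(1)])
    have hf: "pow_norm N q (h n) \<le> pow_norm N q f" for n
      unfolding pow_norm_def
    proof (rule powr_mono2)
      show "0 \<le> N (\<lambda>x. \<bar>h n x\<bar> powr q)" using h(1) qBfs_nonneg[OF Y] by (simp add: pow_space_def)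
      show "N (\<lambda>x. \<bar>h n x\<bar> powr q) \<le> N (\<lambda>x. \<bar>f x\<bar> powr q)"
        by (rule pow_space_solid(2)[OF Y q f]) (use h(1,2) in \<open>auto simp: pow_space_def sp\<close>)
    qed (use q in simp)
    have "(\<lambda>n. pow_norm N q (?s n)) \<longlonglongrightarrow> 0"
    proof (rule tendsto_sandwich[OF _ _ tendsto_const])
      show "\<forall>\<^sub>F n in sequentially. 0 \<le> pow_norm N q (?s n)" by (simp add: pow_norm_def)
      show "\<forall>\<^sub>F n in sequentially. pow_norm N q (?s n) \<le> 1 / real (Suc n) * pow_norm N q f"
      proof (intro always_eventually allI)
        fix n
        have "pow_norm N q (?s n) = \<bar>1 / real (Suc n)\<bar> * pow_norm N q (h n)"
          by (rule pow_space_scale(2)[OF Y q h(1)])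
        also have "\<dots> \<le> 1 / real (Suc n) * pow_norm N q f" using hf[of n] by (simp add: divide_right_mono)
        finally show "pow_norm N q (?s n) \<le> 1 / real (Suc n) * pow_norm N q f" .
      qed
      show "(\<lambda>n. 1 / real (Suc n) * pow_norm N q f) \<longlonglongrightarrow> 0"
        by (rule tendsto_mult_left_zero) (use LIMSEQ_Suc[OF lim_inverse_n'] in simp)
    qed
    from cont[OF sD this] have lim0: "(\<lambda>n. norm (U (?s n))) \<longlonglongrightarrow> 0" by (rule tendsto_norm_zero)
    have "1 \<le> norm (U (?s n))" for n
    proof -
      have "U (?s n) = (1 / real (Suc n)) *\<^sub>R U (h n)" using lin h(1) unfolding linear_on_def by blast
      then show ?thesis using h(3)[of n] by (simp add: field_simps)
    qed
    then have "(1::real) \<le> 0" by (intro LIMSEQ_le_const[OF lim0]) auto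
    then show False by simp
  qed
  fix s :: "nat \<Rightarrow> 'a \<Rightarrow> real"
  assume s: "\<And>n. s n \<in> ?D" "\<And>n x. x \<in> space M \<Longrightarrow> s (Suc n) x \<le> s n x"
    "\<And>x. x \<in> space M \<Longrightarrow> (\<lambda>n. s n x) \<longlonglongrightarrow> 0"
  \<comment> \<open>A sequence decreasing to 0 is nonnegative; this makes |s n|^q decreasing as
    well.\<close>
  have nonneg: "0 \<le> s n x" if "x \<in> space M" for n x
    by (rule decseq_ge[OF _ s(3)[OF that]]) (simp add: decseq_Suc_iff s(2)[OF that])
  have "(\<lambda>n. N (\<lambda>x. \<bar>s n x\<bar> powr q)) \<longlonglongrightarrow> 0"
  proof (rule soc[unfolded sigma_order_continuous_def, rule_format])
    show "(\<lambda>x. \<bar>s n x\<bar> powr q) \<in> Y" for n using s(1) by (simp add: pow_space_def)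
    show "AE x in L. (\<forall>n. \<bar>s (Suc n) x\<bar> powr q \<le> \<bar>s n x\<bar> powr q) \<and> (\<lambda>n. \<bar>s n x\<bar> powr q) \<longlonglongrightarrow> 0"
    proof (rule AE_I2)
      fix x assume "x \<in> space L"
      then have x: "x \<in> space M" by (simp add: sp)
      have "\<bar>s (Suc n) x\<bar> powr q \<le> \<bar>s n x\<bar> powr q" for n
        using nonneg[OF x] s(2)[OF x] q by (intro powr_mono2) auto
      moreover have "(\<lambda>n. \<bar>s n x\<bar> powr q) \<longlonglongrightarrow> 0"
        by (rule tendsto_zero_powrI[OF tendsto_rabs_zero[OF s(3)[OF x]] tendsto_const _ q]) simp
      ultimately show "(\<forall>n. \<bar>s (Suc n) x\<bar> powr q \<le> \<bar>s n x\<bar> powr q) \<and> (\<lambda>n. \<bar>s n x\<bar> powr q) \<longlonglongrightarrow> 0"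
        by blast
    qed
  qed
  then have "(\<lambda>n. pow_norm N q (s n)) \<longlonglongrightarrow> 0"
    unfolding pow_norm_def
    by (rule tendsto_zero_powrI[OF _ tendsto_const])
      (use q s(1) qBfs_nonneg[OF Y] in \<open>auto simp: pow_space_def\<close>)
  then show "(\<lambda>n. U (s n)) \<longlonglongrightarrow> 0" by (rule cont[OF s(1)])
qed

text \<open>Formulated for a measure L with possibly other null sets than M, so that it applies to X
  with T and to Z with S. In both cases R and m come from X, and one extension U represents
  integration on both Y and its power 1 / p.\<close>

lemma factorable_imp_vm_L1:
  fixes S :: "('a \<Rightarrow> real) \<Rightarrow> 'b::banach"
  assumes cover: "\<exists>\<Omega>::nat \<Rightarrow> 'a set. (\<forall>n. \<Omega> n \<in> R) \<and> (\<Union>n. \<Omega> n) = space M"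
    and L: "sets L = sets M" and Y: "qBfs L Y N" and soc: "sigma_order_continuous L Y N" and p: "0 < p"
    and R_ind: "\<And>A. A \<in> R \<Longrightarrow> indicator A \<in> Y" and S_ind: "\<And>A. A \<in> R \<Longrightarrow> S (indicator A) = m A"
    and fact: "pth_power_factorable L Y N p S"
  shows "bounded_vector_charge M R m"
    and "absolutely_continuous L (ctrl_measure M R m)"
    and "Y \<subseteq> LpL1 M R m p"
    and "f \<in> Y \<Longrightarrow> S f = vm_int M R m f"
proof -
  obtain U where U: "linear_on (sum_space L Y p) U" "respects_ae L (sum_space L Y p) U"
    "qcontinuous (sum_space L Y p) (sum_norm L Y N p) U" "\<And>f. f \<in> Y \<Longrightarrow> U f = S f"
    using fact unfolding pth_power_factorable_def by blast
  have U_ind: "U (indicator A) = m A" if "A \<in> R" for A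
    using U(4)[OF R_ind[OF that]] S_ind[OF that] by simp
  have op: "order_continuous_operator M R m (pow_space L Y q) U" if q: "q = 1 \<or> q = 1 / p" for q
  proof (rule order_continuous_operator_pow_space[where m = m and U = U, OF cover L Y soc])
    show "indicator A \<in> Y" "U (indicator A) = m A" if "A \<in> R" for A by (rule R_ind[OF that], rule U_ind[OF that])
    show "0 < q" using q p by auto
    show "linear_on (pow_space L Y q) U"
      using U(1) pow_space_subset_sum_space(1)[OF Y q] unfolding linear_on_def by blast
  qed (rule factorable_continuous[OF Y q U(1,3)])
  interpret Y: order_continuous_operator M R m Y U
    using op[of 1] by (simp add: pow_space_1[OF Y])
  interpret Yp: order_continuous_operator M R m "pow_space L Y (1 / p)" U
    by (rule op) simp
  show "bounded_vector_charge M R m" by (rule Y.bounded_vector_charge_axioms)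
  show Y_sub: "Y \<subseteq> LpL1 M R m p"
  proof
    fix f assume f: "f \<in> Y"
    then have fm: "f \<in> borel_measurable L" using qBfsD(1)[OF Y] by blast
    have "(\<lambda>x. \<bar>f x\<bar>) \<in> Y"
      using qBfsD(5)[OF Y f, of "\<lambda>x. \<bar>f x\<bar>"] fm by simp
    then have "(\<lambda>x. \<bar>f x\<bar> powr p) \<in> pow_space L Y (1 / p)"
      using fm p by (simp add: pow_space_def powr_powr)
    then have "(\<lambda>x. \<bar>f x\<bar> powr p) \<in> vm_L1 M R m" using Yp.D_subset_L1 by blast
    moreover have "f \<in> vm_L1 M R m" using Y.D_subset_L1 f by blast
    ultimately show "f \<in> LpL1 M R m p"
      using Y.vm_L1D(1) by (auto simp: LpL1_def vm_Lp_def)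
  qed
  show "S f = vm_int M R m f" if "f \<in> Y" using Y.vm_int_eq[OF that] U(4)[OF that] by simp
  show "absolutely_continuous L (ctrl_measure M R m)"
    unfolding absolutely_continuous_def
  proof
    fix A assume A: "A \<in> null_sets L"
    \<comment> \<open>The variation on A is computed from members of R inside A. Their indicators
      vanish L-almost everywhere, and U respects almost everywhere equality.\<close>
    have "m B = 0" if B: "B \<in> R" "B \<subseteq> A" for B
    proof -
      have z: "(\<lambda>x. 0) \<in> Y" by (rule qBfsD(2)[OF Y])
      have "AE x in L. indicator B x = (0::real)"
        using AE_not_in[OF A] by eventually_elim (use B(2) in \<open>auto simp: indicator_def\<close>)
      moreover have "Y \<subseteq> sum_space L Y p"
        using pow_space_subset_sum_space(1)[OF Y, of 1] pow_space_1[OF Y] by auto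
      ultimately have "U (indicator B) = U (\<lambda>x. 0)"
        using U(2)[unfolded respects_ae_def, rule_format, of "indicator B" "\<lambda>x. 0"] R_ind[OF B(1)] z
        by (auto dest: subsetD)
      also have "\<dots> = 0" by (rule linear_on_zero[OF Y.U_lin z])
      finally show ?thesis using U_ind[OF B(1)] by simp
    qed
    note mB = this
    have "vm_null M R m A"
      unfolding vm_null_def
    proof (intro conjI ballI)
      show "A \<in> sets M" using A L by (auto simp: null_sets_def)
      fix xs :: "'b \<Rightarrow> real" assume xs: "xs \<in> dual_ball"
      have "(\<Sum>B\<in>F. ennreal \<bar>xs (m B)\<bar>) = 0" if "F \<subseteq> R" "\<Union>F \<subseteq> A" for F
      proof (rule sum.neutral, rule ballI)
        fix B assume "B \<in> F"
        then have "m B = 0" using that by (intro mB) auto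
        then show "ennreal \<bar>xs (m B)\<bar> = 0" by (simp add: linear_0[OF dual_ball_linear[OF xs]])
      qed
      then show "variation R (\<lambda>B. xs (m B)) A = 0"
        unfolding variation_def by (intro antisym SUP_least) auto
    qed
    then show "A \<in> null_sets (ctrl_measure M R m)" by (simp add: Y.null_sets_C)
  qed
qed

end

section \<open>The ring of sets attached to X, and the factorization\<close>

lemma set_ideal_sigma_X:
  assumes X: "qBfs M X NX"
  shows "set_ideal M (sigma_X M X)"
proof
  fix A B assume A: "A \<in> sigma_X M X" and B: "B \<in> sets M" "B \<subseteq> A"
  have "AE x in M. \<bar>indicator B x\<bar> \<le> \<bar>indicator A x :: real\<bar>"
    using B(2) by (intro AE_I2) (auto simp: indicator_def)
  then show "B \<in> sigma_X M X"
    using A B qBfsD(5)[OF X, where f = "indicator A" and g = "indicator B"] by (simp add: sigma_X_def)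
next
  fix A B assume AB: "A \<in> sigma_X M X" "B \<in> sigma_X M X"
  then have "(\<lambda>x. indicator A x + indicator B x) \<in> X"
    using qBfsD(3)[OF X] by (simp add: sigma_X_def)
  moreover have "AE x in M. \<bar>indicator (A \<union> B) x\<bar> \<le> \<bar>indicator A x + indicator B x :: real\<bar>"
    by (intro AE_I2) (auto simp: indicator_def)
  ultimately show "A \<union> B \<in> sigma_X M X"
    using AB qBfsD(5)[OF X, where g = "indicator (A \<union> B)"] by (auto simp: sigma_X_def)
next
  have "indicator {} = (\<lambda>x :: 'a. 0 :: real)" by (simp add: fun_eq_iff)
  then have "(indicator {} :: 'a \<Rightarrow> real) \<in> X" using qBfsD(2)[OF X] by (simp only:)
  then show "{} \<in> sigma_X M X" by (simp add: sigma_X_def)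
qed (auto simp: sigma_X_def)

theorem theorem6p2:
  fixes M :: "'a measure" and X :: "('a \<Rightarrow> real) set" and NX :: "('a \<Rightarrow> real) \<Rightarrow> real"
    and T :: "('a \<Rightarrow> real) \<Rightarrow> 'b::banach" and p :: real
  assumes X_qBfs: "qBfs M X NX"
    and X_soc: "sigma_order_continuous M X NX"
    and X_sigma: "sigma_property M X"
    and p_pos: "0 < p"
    and T_lin: "linear_on X T" and T_ae: "respects_ae M X T"
    and T_fact: "pth_power_factorable M X NX p T"
  shows "(absolutely_continuous M (ctrl_measure M (sigma_X M X) (mT T))
            \<and> X \<subseteq> LpL1 M (sigma_X M X) (mT T) p)
       \<and> (\<forall>f\<in>X. T f = vm_int M (sigma_X M X) (mT T) f)
       \<and> pth_power_factorable (ctrl_measure M (sigma_X M X) (mT T)) (LpL1 M (sigma_X M X) (mT T) p)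
            (LpL1_norm M (sigma_X M X) (mT T) p) p (vm_int M (sigma_X M X) (mT T))
       \<and> (\<forall>(\<xi>::'a measure) Z NZ (S :: ('a \<Rightarrow> real) \<Rightarrow> 'b).
            sets \<xi> = sets M \<longrightarrow> absolutely_continuous M \<xi> \<longrightarrow>
            qBfs \<xi> Z NZ \<longrightarrow> sigma_order_continuous \<xi> Z NZ \<longrightarrow> X \<subseteq> Z \<longrightarrow>
            linear_on Z S \<longrightarrow> respects_ae \<xi> Z S \<longrightarrow> (\<forall>f\<in>X. T f = S f) \<longrightarrow>
            pth_power_factorable \<xi> Z NZ p S \<longrightarrow>
            (absolutely_continuous \<xi> (ctrl_measure M (sigma_X M X) (mT T))
               \<and> Z \<subseteq> LpL1 M (sigma_X M X) (mT T) p)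
            \<and> (\<forall>f\<in>Z. S f = vm_int M (sigma_X M X) (mT T) f))"
proof -
  let ?R = "sigma_X M X" and ?m = "mT T"
  interpret set_ideal M ?R by (rule set_ideal_sigma_X[OF X_qBfs])
  have cover: "\<exists>\<Omega>::nat \<Rightarrow> 'a set. (\<forall>n. \<Omega> n \<in> ?R) \<and> (\<Union>n. \<Omega> n) = space M"
    using X_sigma by (auto simp: sigma_property_def sigma_X_def)
  have R_ind: "indicator A \<in> X" if "A \<in> ?R" for A using that by (simp add: sigma_X_def)
  have T_ind: "T (indicator A) = ?m A" for A by (simp add: mT_def)
  note X_L1 = factorable_imp_vm_L1[OF cover refl X_qBfs X_soc p_pos R_ind T_ind T_fact]
  have Z_L1: "(absolutely_continuous \<xi> (ctrl_measure M ?R ?m) \<and> Z \<subseteq> LpL1 M ?R ?m p)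
      \<and> (\<forall>f\<in>Z. S f = vm_int M ?R ?m f)"
    if \<xi>: "sets \<xi> = sets M" and Z: "qBfs \<xi> Z NZ" "sigma_order_continuous \<xi> Z NZ" "X \<subseteq> Z"
      and TS: "\<forall>f\<in>X. T f = S f" and S: "pth_power_factorable \<xi> Z NZ p S"
    for \<xi> :: "'a measure" and Z NZ and S :: "('a \<Rightarrow> real) \<Rightarrow> 'b"
  proof -
    \<comment> \<open>Since X is contained in Z and S agrees with T on X, the operator S induces the
      same vector charge on \<open>sigma_X M X\<close>.\<close>
    have "indicator A \<in> Z" "S (indicator A) = ?m A" if "A \<in> ?R" for A
      using R_ind[OF that] Z(3) TS by (auto simp: mT_def)
    note * = factorable_imp_vm_L1[OF cover \<xi> Z(1,2) p_pos this S]
    show ?thesis using *(2,3,4) by blast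
  qed
  show ?thesis
    using X_L1(2-4) bounded_vector_charge.vm_int_factorable[OF X_L1(1) p_pos] Z_L1 by blast
qed

end
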